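(* Let $G$ be a group, let $V$ and $W$ be $G$-modules, let $\phi:V\rightarrow W$ be a $G$-equivariant surjection, and let $\phi^{*}:F[W]\hookrightarrow F[V]$ be the corresponding inclusion. Let $S\subseteq F[W]^G$ be a separating set for $W$, and let $T\subseteq F[V]^G$ be a set of invariant polynomials such that if $v_1,v_2\in V$ are in different $G$-orbits and if $\phi(v_1)=\phi(v_2)$, then there is a polynomial $f\in T$ such that $f(v_1)\neq f(v_2)$. Then $\phi^{*}(S)\cup T$ is a separating set for $V$.
   Context: $F$ is an algebraically closed field. A $G$-module is a finite dimensional representation of the group $G$ over $F$. For a $G$-module $V$, $F[V]:=S(V^{*})$ is the symmetric algebra on $V^*$, with induced $G$-action $\sigma(f)=f\circ\sigma^{-1}$ for $\sigma\in G$ and $f\in F[V]$, and $F[V]^G$ denotes the subalgebra of invariant polynomials in $F[V]$. A subset $A\subseteq F[V]^G$ is said to be separating for $V$ (a separating set for $V$) if for any pair of vectors $u,w\in V$: if $f(u)=f(w)$ for all $f\in A$, then $f(u)=f(w)$ for all $f\in F[V]^G$. The inclusion $\phi^{*}$ is given by $f\mapsto f\circ\phi$. *)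

theory Defs
  imports
    Complex_Main
    "HOL-Algebra.Group_Action"
    "HOL-Computational_Algebra.Polynomial"
begin

text \<open>A vector space is a scalar multiplication \<open>s\<close> on a whole type \<open>'v\<close>; the group is a
  HOL-Algebra group, arbitrary and possibly infinite. \<open>group_action G UNIV \<rho>\<close> says that \<open>\<rho>\<close> is a
  group homomorphism from \<open>G\<close> into the bijections of \<open>'v\<close>.\<close>

locale G_module = group_action G UNIV \<rho> + vector_space s
  for G :: "('g, 'm) monoid_scheme" (structure)
    and s :: "'f::field \<Rightarrow> 'v::ab_group_add \<Rightarrow> 'v"
    and \<rho> :: "'g \<Rightarrow> 'v \<Rightarrow> 'v" +
  assumes finite_dim: "\<exists>B. finite B \<and> span B = UNIV"
    and linear_action: "g \<in> carrier G \<Longrightarrow> Vector_Spaces.linear s s (\<rho> g)"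

definition G_equivariant ::
    "('g, 'm) monoid_scheme \<Rightarrow> ('g \<Rightarrow> 'v \<Rightarrow> 'v) \<Rightarrow> ('g \<Rightarrow> 'w \<Rightarrow> 'w) \<Rightarrow> ('v \<Rightarrow> 'w) \<Rightarrow> bool" where
  "G_equivariant G \<rho> \<tau> \<phi> \<longleftrightarrow> (\<forall>g\<in>carrier G. \<forall>v. \<phi> (\<rho> g v) = \<tau> g (\<phi> v))"

text \<open>\<open>F[V] = S(V\<^sup>*)\<close>, realised as the \<open>F\<close>-subalgebra of all functions \<open>V \<Rightarrow> F\<close> generated by the
  dual space \<open>V\<^sup>*\<close>. An algebraically closed field is infinite, so for finite-dimensional \<open>V\<close>
  evaluation identifies the symmetric algebra with this algebra of functions.\<close>

inductive_set polynomial_functions ::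
    "('f::field \<Rightarrow> 'v::ab_group_add \<Rightarrow> 'v) \<Rightarrow> ('v \<Rightarrow> 'f) set"
  for s :: "'f::field \<Rightarrow> 'v::ab_group_add \<Rightarrow> 'v" where
  const: "(\<lambda>v. c) \<in> polynomial_functions s"
| dual: "Vector_Spaces.linear s (*) l \<Longrightarrow> l \<in> polynomial_functions s"
| add: "p \<in> polynomial_functions s \<Longrightarrow> q \<in> polynomial_functions s \<Longrightarrow>
    (\<lambda>v. p v + q v) \<in> polynomial_functions s"
| mult: "p \<in> polynomial_functions s \<Longrightarrow> q \<in> polynomial_functions s \<Longrightarrow>
    (\<lambda>v. p v * q v) \<in> polynomial_functions s"

definition invariant_polynomials ::
    "('g, 'm) monoid_scheme \<Rightarrow> ('f::field \<Rightarrow> 'v::ab_group_add \<Rightarrow> 'v) \<Rightarrow> ('g \<Rightarrow> 'v \<Rightarrow> 'v) \<Rightarrow>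
      ('v \<Rightarrow> 'f) set" where
  "invariant_polynomials G s \<rho> =
    {f \<in> polynomial_functions s. \<forall>g\<in>carrier G. f \<circ> \<rho> (inv\<^bsub>G\<^esub> g) = f}"

definition separating_set ::
    "('g, 'm) monoid_scheme \<Rightarrow> ('f::field \<Rightarrow> 'v::ab_group_add \<Rightarrow> 'v) \<Rightarrow> ('g \<Rightarrow> 'v \<Rightarrow> 'v) \<Rightarrow>
      ('v \<Rightarrow> 'f) set \<Rightarrow> bool" where
  "separating_set G s \<rho> A \<longleftrightarrow>
    A \<subseteq> invariant_polynomials G s \<rho> \<and>
    (\<forall>u w. (\<forall>f\<in>A. f u = f w) \<longrightarrow> (\<forall>f\<in>invariant_polynomials G s \<rho>. f u = f w))"

definition pullback :: "('v \<Rightarrow> 'w) \<Rightarrow> ('w \<Rightarrow> 'f) \<Rightarrow> 'v \<Rightarrow> 'f" where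
  "pullback \<phi> f = f \<circ> \<phi>"

end

theory Submission
  imports Defs "Jordan_Normal_Form.Determinant" "HOL-Library.Product_Plus"
begin

text \<open>
  Suppose \<open>\<phi>\<^sup>*(S) \<union> T\<close> does not distinguish \<open>u\<close> and \<open>w\<close>. If \<open>\<phi> u\<close> and \<open>\<phi> w\<close> lay in one orbit, \<open>w\<close> could
  be moved into the fibre of \<open>u\<close>, and \<open>T\<close> would finish the proof. For an infinite group, however,
  points of \<open>W\<close> that all invariants identify need not lie in one orbit. What has to be shown
  instead is a lifting property: if all invariants of \<open>W\<close> agree at \<open>\<phi> u\<close> and \<open>\<phi> w\<close>, then some
  translate \<open>w' = a w + k\<close> with \<open>a \<in> G\<close> and \<open>k \<in> K = ker \<phi>\<close> has the same invariants as \<open>u\<close>. Then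
  \<open>T\<close> takes equal values at \<open>w'\<close>, \<open>u\<close>, \<open>w\<close> and \<open>a w\<close>; since \<open>w'\<close> and \<open>a w\<close> lie in one fibre of \<open>\<phi>\<close>,
  the hypothesis on \<open>T\<close> puts them into one orbit, so every invariant agrees at \<open>u\<close> and \<open>w\<close>.

  The lifting property comes from elimination theory. On \<open>K\<close> the hypothesis on \<open>T\<close> says in
  particular that every nonzero \<open>k\<close> is distinguished from \<open>0\<close> by an invariant, hence some
  homogeneous invariant of positive degree does not vanish at \<open>k\<close>. This is used twice.

  (1) A fibre in \<open>K\<close> of the homogeneous invariants is an affine variety without points at infinity,
  so it is finite (\<open>finite_fibre_of_homogeneous_functions\<close>). Hence \<open>G\<close> has finite orbits on
  \<open>K\<close>, and the subgroup \<open>N\<close> of those elements that fix \<open>K\<close> pointwise has finite index. Multiplying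
  the finitely many \<open>G\<close>-translates of an \<open>N\<close>-invariant function that is constant along \<open>K\<close> yields
  a \<open>G\<close>-invariant which comes from \<open>W\<close>; from this, \<open>u\<close> and some \<open>a w\<close> have the same
  \<open>N\<close>-invariants among the functions constant along \<open>K\<close>.

  (2) \<open>N\<close> commutes with the translations by elements of \<open>K\<close>, so one can pass from \<open>F[V]\<^sup>N\<close> to
  its \<open>K\<close>-invariant part one direction \<open>e \<in> K\<close> at a time. A homogeneous function that does not
  vanish at \<open>e\<close> is, up to a unit, a monic polynomial on each line parallel to \<open>e\<close>, and taking
  resultants with it eliminates the direction \<open>e\<close>: a zero of the eliminated ideal lifts to a
  zero of the ideal on the same line (\<open>eliminate_one_direction\<close>). Iterating along a basis of \<open>K\<close>
  gives \<open>lift_along_pointwise_fixed_subspace\<close>. The finiteness in (1) comes from the same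
  elimination, applied to a cone.
\<close>

section \<open>Resultants over an algebraically closed field\<close>

lemma infinite_UNIV_alg_closed_field: "infinite (UNIV :: 'f::alg_closed_field set)"
proof
  assume fin: "finite (UNIV :: 'f set)"
  let ?p = "(\<Prod>a\<in>(UNIV::'f set). [:-a, 1:])"
  have "degree ?p = card (UNIV :: 'f set)"
    by (subst degree_prod_sum_eq) auto
  also have "\<dots> > 0" using fin by (simp add: finite_UNIV_card_ge_0)
  finally have d: "degree ?p > 0" .
  then have "degree (?p + 1) > 0" by (subst degree_add_eq_left) auto
  then obtain x where "poly (?p + 1) x = 0"
    using alg_closed_imp_poly_has_root by blast
  moreover have "poly ?p x = 0"
    using fin by (auto simp: poly_prod intro!: bexI[of _ x])
  ultimately show False by simp
qed

lemma poly_eqI_nonzero: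
  fixes p q :: "'f::alg_closed_field poly"
  assumes "\<And>t. t \<noteq> 0 \<Longrightarrow> poly p t = poly q t"
  shows "p = q"
proof (rule ccontr)
  assume "p \<noteq> q"
  then have "finite {t. poly (p - q) t = 0}" by (intro poly_roots_finite) auto
  moreover have "UNIV - {0} \<subseteq> {t. poly (p - q) t = 0}" using assms by auto
  ultimately have "finite (UNIV - {0::'f})" by (rule rev_finite_subset)
  then show False using infinite_UNIV_alg_closed_field[where 'f='f] by simp
qed

text \<open>
  A linear space of functions over an infinite field is not a finite union of proper subspaces: if
  \<open>f\<close> is nonzero on \<open>P\<close> and \<open>h\<close> at one more point, all but finitely many of the combinations
  \<open>f + c h\<close> are nonzero at every point concerned.
\<close>

lemma generic_nonvanishing:
  fixes J :: "('v \<Rightarrow> 'f::alg_closed_field) set"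
  assumes "finite P" and "J \<noteq> {}"
    and add: "\<And>f g. f \<in> J \<Longrightarrow> g \<in> J \<Longrightarrow> (\<lambda>v. f v + g v) \<in> J"
    and scale: "\<And>c f. f \<in> J \<Longrightarrow> (\<lambda>v. c * f v) \<in> J"
    and "\<And>x. x \<in> P \<Longrightarrow> \<exists>f\<in>J. f x \<noteq> 0"
  shows "\<exists>f\<in>J. \<forall>x\<in>P. f x \<noteq> 0"
  using assms(1,5)
proof (induction P)
  case empty
  then show ?case using \<open>J \<noteq> {}\<close> by auto
next
  case (insert y P)
  then obtain f where f: "f \<in> J" "\<forall>x\<in>P. f x \<noteq> 0" by auto
  from insert.prems obtain h where h: "h \<in> J" "h y \<noteq> 0" by auto
  have "finite ((\<lambda>x. - f x / h x) ` insert y P)" using insert.hyps by simp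
  then obtain c where c: "c \<notin> (\<lambda>x. - f x / h x) ` insert y P"
    using ex_new_if_finite infinite_UNIV_alg_closed_field by blast
  have "f x + c * h x \<noteq> 0" if x: "x \<in> insert y P" for x
  proof (cases "h x = 0")
    case True
    then show ?thesis using x f h by auto
  next
    case False
    then have "c \<noteq> - f x / h x" using c x by blast
    moreover have "c = - f x / h x" if "f x + c * h x = 0"
    proof -
      have "f x = - (c * h x)" using that by (rule eq_neg_iff_add_eq_0[THEN iffD2])
      then show ?thesis using False by simp
    qed
    ultimately show ?thesis by blast
  qed
  moreover have "(\<lambda>v. f v + c * h v) \<in> J" by (intro add scale f h)
  ultimately show ?case by (intro bexI[of _ "\<lambda>v. f v + c * h v"]) auto
qed

lemma sum_lessThan_add:
  fixes f :: "nat \<Rightarrow> 'a::comm_monoid_add"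
  shows "(\<Sum>i<m + n. f i) = (\<Sum>i<m. f i) + (\<Sum>i<n. f (m + i))"
  by (induction n) (auto simp: add.assoc)

text \<open>
  The Sylvester matrix for formal degrees \<open>q\<close> of \<open>g\<close> and \<open>m\<close> of \<open>h\<close>. The sizes are parameters and
  not the actual degrees because the matrix is applied to polynomials that vary with a point,
  where the degree of \<open>h\<close> may drop.
\<close>

definition sylvester :: "nat \<Rightarrow> nat \<Rightarrow> 'f::field poly \<Rightarrow> 'f poly \<Rightarrow> 'f mat" where
  "sylvester m q g h = mat (m + q) (m + q)
     (\<lambda>(i, j). coeff (if i < m then monom 1 i * g else monom 1 (i - m) * h) j)"

lemma sylvester_carrier [simp]: "sylvester m q g h \<in> carrier_mat (m + q) (m + q)"
  by (simp add: sylvester_def)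

lemma degree_monom_mult_less:
  fixes p :: "'f::field poly"
  assumes "degree p \<le> d" "i < n"
  shows "degree (monom 1 i * p) < n + d"
  using degree_mult_le[of "monom 1 i" p] assms degree_monom_le[of "1::'f" i] by linarith

text \<open>
  Euclid's lemma with "no common root" in place of "coprime". Since \<open>g\<close> splits into linear
  factors, it suffices to split off one root after the other.
\<close>

lemma dvd_mult_right_if_no_common_root:
  fixes g B h :: "'f::alg_closed_field poly"
  assumes "g dvd B * h" and "g \<noteq> 0" and "\<nexists>t. poly g t = 0 \<and> poly h t = 0"
  shows "g dvd B"
  using assms
proof (induction "degree g" arbitrary: g B)
  case 0
  then have "is_unit g" by (simp add: is_unit_iff_degree)
  then show ?case by (rule unit_imp_dvd)
next
  case (Suc n)
  then obtain a where a: "poly g a = 0"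
    using alg_closed_imp_poly_has_root by (metis zero_less_Suc)
  then obtain g' where g': "g = [:-a, 1:] * g'" by (auto simp: poly_eq_0_iff_dvd)
  have "poly (B * h) a = 0" using Suc.prems(1) a by (metis dvdE poly_mult mult_zero_left)
  then have "poly B a = 0" using Suc.prems(3) a by auto
  then obtain B' where B': "B = [:-a, 1:] * B'" by (auto simp: poly_eq_0_iff_dvd)
  have g'0: "g' \<noteq> 0" using Suc.prems(2) g' by auto
  have "degree g = degree [:-a, 1:] + degree g'"
    unfolding g' using g'0 by (intro degree_mult_eq) auto
  then have "n = degree g'" using Suc.hyps(2) by simp
  moreover have "[:-a, 1:] * g' dvd [:-a, 1:] * (B' * h)"
    using Suc.prems(1) unfolding g' B' by (simp only: mult.assoc)
  then have "g' dvd B' * h" by (subst (asm) dvd_times_left_cancel_iff) auto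
  moreover have "\<nexists>t. poly g' t = 0 \<and> poly h t = 0"
    using Suc.prems(3) by (auto simp: g')
  ultimately have "g' dvd B'" using Suc.hyps(1) g'0 by blast
  then show ?case unfolding g' B' by (rule mult_dvd_mono[OF dvd_refl])
qed

text \<open>
  A vector in the left kernel of the matrix is a relation \<open>A g + B h = 0\<close> with \<open>deg A < m\<close> and
  \<open>deg B < q\<close>. Without a common root \<open>g\<close> would divide \<open>B\<close>, which is too small. It matters that
  \<open>g\<close> has exact degree \<open>q\<close>, whereas \<open>m\<close> only bounds the degree of \<open>h\<close>.
\<close>

lemma det_sylvester_eq_0_imp_common_root:
  fixes g h :: "'f::alg_closed_field poly"
  assumes g: "degree g \<le> q" "coeff g q \<noteq> 0" and h: "degree h \<le> m"
    and det: "det (sylvester m q g h) = 0"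
  shows "\<exists>t. poly g t = 0 \<and> poly h t = 0"
proof (rule ccontr)
  assume no_root: "\<nexists>t. poly g t = 0 \<and> poly h t = 0"
  let ?S = "sylvester m q g h"
  let ?n = "m + q"
  have g0: "g \<noteq> 0" using g by auto
  have dg: "degree g = q" using g by (simp add: le_antisym le_degree)
  have "det (transpose_mat ?S) = 0"
    using det det_transpose[OF sylvester_carrier] by metis
  then obtain x where x: "x \<in> carrier_vec ?n" "x \<noteq> 0\<^sub>v ?n"
      and Sx: "transpose_mat ?S *\<^sub>v x = 0\<^sub>v ?n"
    using det_0_iff_vec_prod_zero[of "transpose_mat ?S" ?n] by auto
  define A where "A = (\<Sum>i<m. monom (x $ i) i)"
  define B where "B = (\<Sum>i<q. monom (x $ (m + i)) i)"
  have cA: "coeff A i = (if i < m then x $ i else 0)" for i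
    by (simp add: A_def coeff_sum)
  have cB: "coeff B i = (if i < q then x $ (m + i) else 0)" for i
    by (simp add: B_def coeff_sum)
  have smult_monom_mult: "monom c i * p = Polynomial.smult c (monom 1 i * p)" for c i and p :: "'f poly"
    by (metis mult.right_neutral mult_smult_left smult_monom)
  have row: "A * g + B * h = (\<Sum>i<?n. Polynomial.smult (x $ i) (if i < m then monom 1 i * g else monom 1 (i - m) * h))"
  proof -
    have "(\<Sum>i<?n. Polynomial.smult (x $ i) (if i < m then monom 1 i * g else monom 1 (i - m) * h))
      = (\<Sum>i<m. Polynomial.smult (x $ i) (monom 1 i * g)) + (\<Sum>i<q. Polynomial.smult (x $ (m + i)) (monom 1 i * h))"
      by (simp add: sum_lessThan_add)
    also have "\<dots> = A * g + B * h"
      by (simp add: A_def B_def sum_distrib_right smult_monom_mult[symmetric])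
    finally show ?thesis by simp
  qed
  have "A * g + B * h = 0"
  proof (rule poly_eqI)
    fix j
    show "coeff (A * g + B * h) j = coeff 0 j"
    proof (cases "j < ?n")
      case True
      have "0 = (transpose_mat ?S *\<^sub>v x) $ j" using Sx True by simp
      also have "\<dots> = (\<Sum>i<?n. ?S $$ (i, j) * x $ i)"
        using True x by (simp add: scalar_prod_def sylvester_def lessThan_atLeast0)
      also have "\<dots> = coeff (A * g + B * h) j"
        unfolding row using True
        by (auto simp: coeff_sum sylvester_def mult.commute intro!: sum.cong)
      finally show ?thesis by simp
    next
      case False
      have "coeff (if i < m then monom 1 i * g else monom 1 (i - m) * h) j = 0" if "i < ?n" for i
      proof (rule coeff_eq_0)
        show "degree (if i < m then monom 1 i * g else monom 1 (i - m) * h) < j"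
          using degree_monom_mult_less[OF g(1), of i m] degree_monom_mult_less[OF h, of "i - m" q]
            that False less_diff_conv2[of m i q] by (auto simp: add.commute not_less)
      qed
      then show ?thesis unfolding row by (simp add: coeff_sum)
    qed
  qed
  then have AB: "A * g = - (B * h)" by (simp add: eq_neg_iff_add_eq_0)
  have dvd: "g dvd B * h" using AB by (metis dvd_minus_iff dvd_triv_right)
  have "g dvd B"
    using dvd g0 no_root by (rule dvd_mult_right_if_no_common_root)
  have B0: "B = 0"
  proof (rule ccontr)
    assume B: "B \<noteq> 0"
    then have "q \<le> degree B" using \<open>g dvd B\<close> dg dvd_imp_degree_le by blast
    moreover have "coeff B (degree B) \<noteq> 0" using B by simp
    ultimately show False by (simp add: cB)
  qed
  then have "A = 0" using AB g0 by simp
  have "x = 0\<^sub>v ?n"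
  proof (rule eq_vecI)
    fix i assume "i < dim_vec (0\<^sub>v ?n :: 'f vec)"
    then show "x $ i = 0\<^sub>v ?n $ i"
      using cA[of i] cB[of "i - m"] \<open>A = 0\<close> B0 less_diff_conv2[of m i q]
      by (cases "i < m") (auto simp: add.commute not_less)
  qed (use x in auto)
  then show False using x by simp
qed

text \<open>
  The resultant lies in the ideal generated by \<open>g\<close> and \<open>h\<close>: the first row of
  \<open>adj S \<cdot> S = det S \<cdot> 1\<close>, applied to the column of powers of \<open>t\<close>. The multipliers are given by
  adjugate entries, so that they depend polynomially on the coefficients of \<open>g\<close> and \<open>h\<close>.
\<close>

lemma det_sylvester_combination:
  fixes g h :: "'f::field poly"
  assumes "degree g \<le> q" "degree h \<le> m" "0 < m"
  defines "C \<equiv> adj_mat (sylvester m q g h)"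
  shows "det (sylvester m q g h) =
    (\<Sum>i<m. C $$ (0, i) * t ^ i) * poly g t + (\<Sum>i<q. C $$ (0, m + i) * t ^ i) * poly h t"
proof -
  let ?S = "sylvester m q g h"
  let ?n = "m + q"
  let ?r = "\<lambda>i. if i < m then monom 1 i * g else monom 1 (i - m) * h"
  have C: "C \<in> carrier_mat ?n ?n" "C * ?S = det ?S \<cdot>\<^sub>m 1\<^sub>m ?n"
    unfolding C_def using adj_mat[OF sylvester_carrier] by auto
  have eval: "poly (?r i) t = (\<Sum>j<?n. ?S $$ (i, j) * t ^ j)" if "i < ?n" for i
  proof -
    have "degree (?r i) < ?n"
      using degree_monom_mult_less[OF assms(1), of i m] degree_monom_mult_less[OF assms(2), of "i - m" q]
        that less_diff_conv2[of m i q] by (auto simp: add.commute not_less)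
    then have "poly (?r i) t = (\<Sum>j<?n. coeff (?r i) j * t ^ j)"
      unfolding poly_altdef by (intro sum.mono_neutral_left) (auto simp: coeff_eq_0)
    then show ?thesis using that by (simp add: sylvester_def)
  qed
  have entry: "(\<Sum>i<?n. C $$ (0, i) * ?S $$ (i, j)) = (if j = 0 then det ?S else 0)" if "j < ?n" for j
  proof -
    have "(\<Sum>i<?n. C $$ (0, i) * ?S $$ (i, j)) = (C * ?S) $$ (0, j)"
      using that C(1) assms(3) by (simp add: scalar_prod_def lessThan_atLeast0 sylvester_def)
    then show ?thesis using that assms(3) C(2) by simp
  qed
  have "det ?S = (\<Sum>j<?n. (if j = 0 then det ?S else 0) * t ^ j)"
    using assms(3) by (subst sum.mono_neutral_right[of _ "{0}"]) auto
  also have "\<dots> = (\<Sum>j<?n. (\<Sum>i<?n. C $$ (0, i) * ?S $$ (i, j)) * t ^ j)"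
    by (intro sum.cong) (auto simp: entry)
  also have "\<dots> = (\<Sum>i<?n. C $$ (0, i) * (\<Sum>j<?n. ?S $$ (i, j) * t ^ j))"
    by (simp add: sum_distrib_right sum_distrib_left mult.assoc) (rule sum.swap)
  also have "\<dots> = (\<Sum>i<?n. C $$ (0, i) * poly (?r i) t)"
    by (intro sum.cong) (auto simp: eval)
  also have "\<dots> = (\<Sum>i<m. C $$ (0, i) * poly (?r i) t) + (\<Sum>i<q. C $$ (0, m + i) * poly (?r (m + i)) t)"
    by (simp add: sum_lessThan_add)
  also have "\<dots> = (\<Sum>i<m. C $$ (0, i) * t ^ i) * poly g t + (\<Sum>i<q. C $$ (0, m + i) * t ^ i) * poly h t"
    by (simp add: poly_monom sum_distrib_right mult.assoc)
  finally show ?thesis .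
qed

section \<open>Elimination along the lines of a flow\<close>

definition subalgebra_of_functions :: "('v \<Rightarrow> 'f::comm_ring_1) set \<Rightarrow> bool" where
  "subalgebra_of_functions R \<longleftrightarrow> (\<forall>c. (\<lambda>v. c) \<in> R) \<and>
     (\<forall>f\<in>R. \<forall>g\<in>R. (\<lambda>v. f v + g v) \<in> R \<and> (\<lambda>v. f v * g v) \<in> R)"

definition ideal_of_functions :: "('v \<Rightarrow> 'f::comm_ring_1) set \<Rightarrow> ('v \<Rightarrow> 'f) set \<Rightarrow> bool" where
  "ideal_of_functions R J \<longleftrightarrow> J \<subseteq> R \<and> J \<noteq> {} \<and>
     (\<forall>f\<in>J. \<forall>g\<in>J. (\<lambda>v. f v + g v) \<in> J) \<and> (\<forall>f\<in>R. \<forall>g\<in>J. (\<lambda>v. f v * g v) \<in> J)"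

lemma
  assumes "subalgebra_of_functions R"
  shows subalgebra_const: "(\<lambda>v. c) \<in> R"
    and subalgebra_add: "f \<in> R \<Longrightarrow> g \<in> R \<Longrightarrow> (\<lambda>v. f v + g v) \<in> R"
    and subalgebra_mult: "f \<in> R \<Longrightarrow> g \<in> R \<Longrightarrow> (\<lambda>v. f v * g v) \<in> R"
  using assms by (auto simp: subalgebra_of_functions_def)

lemma ideal_mult:
  assumes "ideal_of_functions R J"
  shows "f \<in> R \<Longrightarrow> g \<in> J \<Longrightarrow> (\<lambda>v. f v * g v) \<in> J"
  using assms by (auto simp: ideal_of_functions_def)

lemma subalgebra_sum:
  assumes R: "subalgebra_of_functions R" and "\<And>i. i \<in> A \<Longrightarrow> f i \<in> R"
  shows "(\<lambda>v. \<Sum>i\<in>A. f i v) \<in> R"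
  using assms(2)
  by (induction A rule: infinite_finite_induct)
     (auto intro!: subalgebra_const[OF R] subalgebra_add[OF R])

lemma subalgebra_prod:
  assumes R: "subalgebra_of_functions R" and "\<And>i. i \<in> A \<Longrightarrow> f i \<in> R"
  shows "(\<lambda>v. \<Prod>i\<in>A. f i v) \<in> R"
  using assms(2)
  by (induction A rule: infinite_finite_induct)
     (auto intro!: subalgebra_const[OF R] subalgebra_mult[OF R])

lemma subalgebra_det:
  assumes R: "subalgebra_of_functions R"
    and M: "\<And>v. M v \<in> carrier_mat n n"
    and entries: "\<And>i j. i < n \<Longrightarrow> j < n \<Longrightarrow> (\<lambda>v. M v $$ (i, j)) \<in> R"
  shows "(\<lambda>v. det (M v)) \<in> R"
proof -
  have "det (M v) = (\<Sum>p\<in>{p. p permutes {0..<n}}. signof p * (\<Prod>i = 0..<n. M v $$ (i, p i)))" for v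
    using M[of v] by (simp add: det_def')
  moreover have "(\<lambda>v. \<Sum>p\<in>{p. p permutes {0..<n}}. signof p * (\<Prod>i = 0..<n. M v $$ (i, p i))) \<in> R"
    by (intro subalgebra_sum[OF R] subalgebra_mult[OF R] subalgebra_const[OF R]
          subalgebra_prod[OF R] entries) (auto simp: permutes_in_image[of _ "{0..<n}", simplified])
  ultimately show ?thesis by simp
qed

lemma subalgebra_adj_mat:
  assumes R: "subalgebra_of_functions R"
    and M: "\<And>v. M v \<in> carrier_mat n n"
    and entries: "\<And>i j. i < n \<Longrightarrow> j < n \<Longrightarrow> (\<lambda>v. M v $$ (i, j)) \<in> R"
    and ij: "i < n" "j < n"
  shows "(\<lambda>v. adj_mat (M v) $$ (i, j)) \<in> R"
proof -
  have dims: "dim_row (M v) = n" "dim_col (M v) = n" for v using M[of v] by auto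
  have "(\<lambda>v. det (mat_delete (M v) j i)) \<in> R"
  proof (rule subalgebra_det[OF R])
    show "mat_delete (M v) j i \<in> carrier_mat (n - 1) (n - 1)" for v
      using mat_delete_carrier[OF M[of v]] .
    show "(\<lambda>v. mat_delete (M v) j i $$ (k, l)) \<in> R" if "k < n - 1" "l < n - 1" for k l
      using that by (simp add: mat_delete_def dims entries)
  qed
  then have "(\<lambda>v. (-1) ^ (j + i) * det (mat_delete (M v) j i)) \<in> R"
    by (rule subalgebra_mult[OF R subalgebra_const[OF R]])
  then show ?thesis using ij by (simp add: adj_mat_def dims cofactor_def)
qed

text \<open>
  Used with \<open>F v t = f (\<gamma> v t)\<close>, where \<open>t \<mapsto> \<gamma> v t\<close> parametrizes a line attached to the point \<open>v\<close>:
  the restrictions of \<open>f\<close> to all these lines are polynomials of uniformly bounded degree.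
\<close>

definition expansion :: "('v \<Rightarrow> 'f::comm_ring_1 \<Rightarrow> 'f) \<Rightarrow> ('v \<Rightarrow> 'f poly) \<Rightarrow> nat \<Rightarrow> bool" where
  "expansion F p n \<longleftrightarrow> (\<forall>v. degree (p v) \<le> n \<and> (\<forall>t. poly (p v) t = F v t))"

definition coefficient_closed :: "('v \<Rightarrow> 'f \<Rightarrow> 'v) \<Rightarrow> ('v \<Rightarrow> 'f::comm_ring_1) set \<Rightarrow> bool" where
  "coefficient_closed \<gamma> R \<longleftrightarrow> (\<forall>f\<in>R. \<exists>p n. expansion (\<lambda>v t. f (\<gamma> v t)) p n \<and> (\<forall>i. (\<lambda>v. coeff (p v) i) \<in> R))"

lemma expansion_unique:
  fixes p :: "'v \<Rightarrow> 'f::alg_closed_field poly"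
  assumes "expansion F p n" "\<And>t. t \<noteq> 0 \<Longrightarrow> F v t = F w t"
  shows "p v = p w"
  using assms by (intro poly_eqI_nonzero) (simp add: expansion_def)

text \<open>
  The extension step of elimination theory along the orbits of a one-parameter flow \<open>\<gamma>\<close>. For
  \<open>h \<in> J\<close> let \<open>N v\<close> be the resultant of the restrictions of \<open>g\<close> and \<open>h\<close> to the flow line of \<open>v\<close>.
  Then \<open>N \<in> J\<close>, and \<open>N v = 0\<close> iff \<open>g\<close> and \<open>h\<close> have a common zero on that line. The latter condition
  depends on the line only, so the polynomial \<open>s \<mapsto> N (\<gamma> v s)\<close> vanishes everywhere or nowhere and is
  therefore constant. Thus \<open>N\<close> is constant along the flow and must vanish at \<open>w\<close>, so \<open>h\<close> has a zero
  among the finitely many zeros of \<open>g\<close> on the line of \<open>w\<close>. By \<open>generic_nonvanishing\<close>, one of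
  these zeros serves all \<open>h \<in> J\<close>.
\<close>

lemma eliminate_one_direction:
  fixes \<gamma> :: "'v \<Rightarrow> 'f::alg_closed_field \<Rightarrow> 'v"
  assumes flow: "\<And>v. \<gamma> v 0 = v" "\<And>v s t. \<gamma> (\<gamma> v s) t = \<gamma> v (s + t)"
    and R: "subalgebra_of_functions R" and closed: "coefficient_closed \<gamma> R"
    and J: "ideal_of_functions R J"
    and g: "g \<in> J" and p: "expansion (\<lambda>v t. g (\<gamma> v t)) p q" "\<And>i. (\<lambda>v. coeff (p v) i) \<in> R"
    and lead: "c \<noteq> 0" "\<And>v. coeff (p v) q = c"
    and zero: "\<And>f. f \<in> J \<Longrightarrow> (\<And>v t. f (\<gamma> v t) = f v) \<Longrightarrow> f w = 0"
  shows "\<exists>t. \<forall>f\<in>J. f (\<gamma> w t) = 0"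
proof (rule ccontr)
  assume no_zero: "\<nexists>t. \<forall>f\<in>J. f (\<gamma> w t) = 0"
  let ?T = "{t. poly (p w) t = 0}"
  have "p w \<noteq> 0" using lead by (metis coeff_0)
  then have "finite ?T" by (rule poly_roots_finite)
  let ?J' = "(\<lambda>f t. f (\<gamma> w t)) ` J"
  have "\<exists>f\<in>?J'. \<forall>t\<in>?T. f t \<noteq> 0"
  proof (rule generic_nonvanishing[OF \<open>finite ?T\<close>])
    show "?J' \<noteq> {}" using g by auto
    fix f h assume "f \<in> ?J'" "h \<in> ?J'"
    then obtain f' h' where "f' \<in> J" "h' \<in> J" and fh: "f = (\<lambda>t. f' (\<gamma> w t))" "h = (\<lambda>t. h' (\<gamma> w t))"
      by auto
    then have "(\<lambda>v. f' v + h' v) \<in> J" using J by (auto simp: ideal_of_functions_def)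
    then show "(\<lambda>v. f v + h v) \<in> ?J'" unfolding fh by (rule rev_image_eqI) simp
  next
    fix k f assume "f \<in> ?J'"
    then obtain f' where "f' \<in> J" and f: "f = (\<lambda>t. f' (\<gamma> w t))" by auto
    then have "(\<lambda>v. k * f' v) \<in> J"
      using J subalgebra_const[OF R, of k] by (auto simp: ideal_of_functions_def)
    then show "(\<lambda>v. k * f v) \<in> ?J'" unfolding f by (rule rev_image_eqI) simp
  next
    fix t assume "t \<in> ?T"
    show "\<exists>f\<in>?J'. f t \<noteq> 0" using no_zero by auto
  qed
  then obtain h where h: "h \<in> J" and h_nz: "\<And>t. poly (p w) t = 0 \<Longrightarrow> h (\<gamma> w t) \<noteq> 0" by auto
  have "h \<in> R" using h J by (auto simp: ideal_of_functions_def)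
  then obtain r n where r: "expansion (\<lambda>v t. h (\<gamma> v t)) r n" "\<And>i. (\<lambda>v. coeff (r v) i) \<in> R"
    using closed unfolding coefficient_closed_def by blast
  \<comment> \<open>One more than the degree bound, so that the first row of the adjugate exists.\<close>
  define m where "m = Suc n"
  define S where "S v = sylvester m q (p v) (r v)" for v
  define N where "N v = det (S v)" for v
  have dp: "degree (p v) \<le> q" and pe: "poly (p v) t = g (\<gamma> v t)" for v t
    using p(1) by (auto simp: expansion_def)
  have dr: "degree (r v) \<le> m" and re: "poly (r v) t = h (\<gamma> v t)" for v t
    using r(1) by (auto simp: expansion_def m_def le_SucI)
  have S: "S v \<in> carrier_mat (m + q) (m + q)" for v by (simp add: S_def)
  have entries: "(\<lambda>v. S v $$ (i, j)) \<in> R" if "i < m + q" "j < m + q" for i j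
    using that p(2) r(2) subalgebra_const[OF R, of 0]
    by (cases "i < m"; cases "i \<le> j"; cases "i - m \<le> j")
       (simp_all add: S_def sylvester_def coeff_monom_mult)
  have comb: "N v = (\<Sum>i<m. adj_mat (S v) $$ (0, i) * t ^ i) * g (\<gamma> v t)
      + (\<Sum>i<q. adj_mat (S v) $$ (0, m + i) * t ^ i) * h (\<gamma> v t)" for v t
    using det_sylvester_combination[OF dp[of v] dr[of v], of t] by (simp add: N_def S_def pe re m_def)
  \<comment> \<open>Evaluate the combination at \<open>t = 0\<close>, where \<open>\<gamma> v 0 = v\<close>.\<close>
  have "N \<in> J"
  proof -
    have adj: "(\<lambda>v. adj_mat (S v) $$ (0, i)) \<in> R" if "i < m + q" for i
      using subalgebra_adj_mat[OF R S entries, of 0 i] that by (simp add: m_def)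
    have "(\<lambda>v. (\<Sum>i<m. adj_mat (S v) $$ (0, i) * 0 ^ i) * g v) \<in> J"
        "(\<lambda>v. (\<Sum>i<q. adj_mat (S v) $$ (0, m + i) * 0 ^ i) * h v) \<in> J"
      by (intro ideal_mult[OF J] g h subalgebra_sum[OF R] subalgebra_mult[OF R] adj
            subalgebra_const[OF R]; simp add: m_def)+
    then have "(\<lambda>v. (\<Sum>i<m. adj_mat (S v) $$ (0, i) * 0 ^ i) * g v
        + (\<Sum>i<q. adj_mat (S v) $$ (0, m + i) * 0 ^ i) * h v) \<in> J"
      using J by (auto simp: ideal_of_functions_def)
    moreover have "N = (\<lambda>v. (\<Sum>i<m. adj_mat (S v) $$ (0, i) * 0 ^ i) * g v
        + (\<Sum>i<q. adj_mat (S v) $$ (0, m + i) * 0 ^ i) * h v)"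
      using comb[of _ 0] by (simp add: fun_eq_iff flow)
    ultimately show ?thesis by simp
  qed
  have N_zero: "N v = 0 \<longleftrightarrow> (\<exists>t. g (\<gamma> v t) = 0 \<and> h (\<gamma> v t) = 0)" for v
  proof
    assume "N v = 0"
    then show "\<exists>t. g (\<gamma> v t) = 0 \<and> h (\<gamma> v t) = 0"
      using det_sylvester_eq_0_imp_common_root[OF dp[of v] _ dr[of v]] lead
      by (simp add: N_def S_def pe re)
  next
    assume "\<exists>t. g (\<gamma> v t) = 0 \<and> h (\<gamma> v t) = 0"
    then obtain t where "g (\<gamma> v t) = 0" "h (\<gamma> v t) = 0" by auto
    then show "N v = 0" using comb[of v t] by simp
  qed
  have N_shift: "N (\<gamma> v s) = 0 \<longleftrightarrow> N v = 0" for v s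
  proof -
    have "(\<exists>t. g (\<gamma> v (s + t)) = 0 \<and> h (\<gamma> v (s + t)) = 0) \<longleftrightarrow> (\<exists>t. g (\<gamma> v t) = 0 \<and> h (\<gamma> v t) = 0)"
      by (metis add_diff_cancel_left' add.commute diff_add_cancel)
    then show ?thesis by (simp add: N_zero flow)
  qed
  have "N (\<gamma> v s) = N v" for v s
  proof -
    have "N \<in> R" using \<open>N \<in> J\<close> J by (auto simp: ideal_of_functions_def)
    then obtain P k where P: "expansion (\<lambda>v t. N (\<gamma> v t)) P k"
      using closed unfolding coefficient_closed_def by blast
    then have Pe: "poly (P v) t = N (\<gamma> v t)" for t by (simp add: expansion_def)
    show ?thesis
    proof (cases "N v = 0")
      case False
      then have "\<nexists>t. poly (P v) t = 0" by (simp add: Pe N_shift)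
      then have "degree (P v) = 0" using alg_closed_imp_poly_has_root by blast
      then obtain a where "P v = [:a:]" by (rule degree_eq_zeroE)
      then have "poly (P v) s = poly (P v) 0" by simp
      then show ?thesis by (simp add: Pe flow)
    qed (simp add: N_shift)
  qed
  then have "N w = 0" using zero \<open>N \<in> J\<close> by blast
  then show False using h_nz by (auto simp: N_zero pe)
qed

section \<open>Polynomial functions, homogeneous components and elimination of a subspace\<close>

text \<open>
  The generality in \<open>a\<close> and \<open>b\<close> covers the two families of lines that are needed: \<open>v + t e\<close>, along
  which directions are eliminated, and \<open>t v\<close>, which produces homogeneous components.
\<close>

lemma polynomial_function_expansion:
  fixes s :: "'f::field \<Rightarrow> 'v::ab_group_add \<Rightarrow> 'v" and a b :: "'u \<Rightarrow> 'v"
  assumes f: "f \<in> polynomial_functions s" and R: "subalgebra_of_functions R"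
    and ab: "\<And>l. Vector_Spaces.linear s (*) l \<Longrightarrow> (\<lambda>u. l (a u)) \<in> R \<and> (\<lambda>u. l (b u)) \<in> R"
  shows "\<exists>p n. expansion (\<lambda>u t. f (a u + s t (b u))) p n \<and> (\<forall>i. (\<lambda>u. coeff (p u) i) \<in> R)"
  using f
proof induction
  case (const c)
  have "(\<lambda>u. coeff [:c:] i) \<in> R" for i by (rule subalgebra_const[OF R])
  then show ?case by (intro exI[of _ "\<lambda>u. [:c:]"] exI[of _ 0]) (simp add: expansion_def)
next
  case (dual l)
  interpret l: Vector_Spaces.linear s "(*)" l by (rule dual)
  have "(\<lambda>u. coeff [:l (a u), l (b u):] i) \<in> R" for i
    using ab[OF dual] subalgebra_const[OF R, of 0]
    by (cases i; cases "i - 1") (simp_all add: coeff_pCons split: nat.split)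
  then show ?case
    by (intro exI[of _ "\<lambda>u. [:l (a u), l (b u):]"] exI[of _ 1])
       (simp add: expansion_def l.add l.scale)
next
  case (add f g)
  then obtain p n q m where p: "expansion (\<lambda>u t. f (a u + s t (b u))) p n" "\<And>i. (\<lambda>u. coeff (p u) i) \<in> R"
      and q: "expansion (\<lambda>u t. g (a u + s t (b u))) q m" "\<And>i. (\<lambda>u. coeff (q u) i) \<in> R" by auto
  have "expansion (\<lambda>u t. f (a u + s t (b u)) + g (a u + s t (b u))) (\<lambda>u. p u + q u) (max n m)"
    using p(1) q(1) by (auto simp: expansion_def intro!: order.trans[OF degree_add_le_max] max.mono)
  moreover have "(\<lambda>u. coeff (p u + q u) i) \<in> R" for i
    using subalgebra_add[OF R p(2) q(2)] by simp
  ultimately show ?case by blast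
next
  case (mult f g)
  then obtain p n q m where p: "expansion (\<lambda>u t. f (a u + s t (b u))) p n" "\<And>i. (\<lambda>u. coeff (p u) i) \<in> R"
      and q: "expansion (\<lambda>u t. g (a u + s t (b u))) q m" "\<And>i. (\<lambda>u. coeff (q u) i) \<in> R" by auto
  have "expansion (\<lambda>u t. f (a u + s t (b u)) * g (a u + s t (b u))) (\<lambda>u. p u * q u) (n + m)"
    using p(1) q(1) by (auto simp: expansion_def intro!: order.trans[OF degree_mult_le] add_mono)
  moreover have "(\<lambda>u. coeff (p u * q u) i) \<in> R" for i
    unfolding coeff_mult by (intro subalgebra_sum[OF R] subalgebra_mult[OF R] p(2) q(2))
  ultimately show ?case by blast
qed

lemma subalgebra_polynomial_functions: "subalgebra_of_functions (polynomial_functions s)"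
  by (auto simp: subalgebra_of_functions_def intro: polynomial_functions.intros)

locale alg_closed_vector_space = vector_space scale
  for scale :: "'f::alg_closed_field \<Rightarrow> 'v::ab_group_add \<Rightarrow> 'v" (infixr \<open>*s\<close> 75)
begin

text \<open>
  Taking invariants under translations by \<open>U\<close> replaces passing to the quotient by \<open>U\<close>:
  \<open>invariant_functions N U\<close> plays the role of the \<open>N\<close>-invariants in \<open>F[V/U]\<close>, but all functions
  continue to live on the type of \<open>V\<close>.
\<close>

definition invariant_functions :: "('v \<Rightarrow> 'v) set \<Rightarrow> 'v set \<Rightarrow> ('v \<Rightarrow> 'f) set" where
  "invariant_functions N U = {f \<in> polynomial_functions scale.
     (\<forall>\<sigma>\<in>N. \<forall>v. f (\<sigma> v) = f v) \<and> (\<forall>k\<in>U. \<forall>v. f (v + k) = f v)}"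

lemma subalgebra_invariant_functions: "subalgebra_of_functions (invariant_functions N U)"
  using subalgebra_polynomial_functions[of scale]
  by (auto simp: subalgebra_of_functions_def invariant_functions_def)

text \<open>
  A symmetry of \<open>f\<close> that commutes with the translations maps lines to lines, so by uniqueness it
  preserves the coefficients of the restrictions of \<open>f\<close>.
\<close>

lemma coefficient_closed_translation:
  assumes N: "\<And>\<sigma> v t. \<sigma> \<in> N \<Longrightarrow> \<sigma> (v + t *s e) = \<sigma> v + t *s e"
  shows "coefficient_closed (\<lambda>v t. v + t *s e) (invariant_functions N U)"
  unfolding coefficient_closed_def
proof
  fix f assume f: "f \<in> invariant_functions N U"
  then have "f \<in> polynomial_functions scale" by (simp add: invariant_functions_def)
  from this subalgebra_polynomial_functions
  have "\<exists>p n. expansion (\<lambda>v t. f (v + t *s e)) p n \<and>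
      (\<forall>i. (\<lambda>v. coeff (p v) i) \<in> polynomial_functions scale)"
    by (rule polynomial_function_expansion) (auto intro: polynomial_functions.intros)
  then obtain p n where p: "expansion (\<lambda>v t. f (v + t *s e)) p n"
      "\<And>i. (\<lambda>v. coeff (p v) i) \<in> polynomial_functions scale" by auto
  have "p (\<sigma> v) = p v" if "\<sigma> \<in> N" for \<sigma> v
    using f that by (intro expansion_unique[OF p(1)]) (simp add: invariant_functions_def flip: N)
  moreover have "p (v + k) = p v" if "k \<in> U" for k v
  proof (rule expansion_unique[OF p(1)])
    fix t
    have "f (v + k + t *s e) = f ((v + t *s e) + k)" by (simp add: ac_simps)
    also have "\<dots> = f (v + t *s e)" using f that by (simp add: invariant_functions_def)
    finally show "f (v + k + t *s e) = f (v + t *s e)" .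
  qed
  ultimately show "\<exists>p n. expansion (\<lambda>v t. f (v + t *s e)) p n \<and> (\<forall>i. (\<lambda>v. coeff (p v) i) \<in> invariant_functions N U)"
    using p by (intro exI[of _ p] exI[of _ n]) (simp add: invariant_functions_def)
qed

lemma coefficient_closed_scaling:
  assumes N: "\<And>\<sigma> v t. \<sigma> \<in> N \<Longrightarrow> \<sigma> (t *s v) = t *s \<sigma> v" and U: "subspace U"
  shows "coefficient_closed (\<lambda>v t. t *s v) (invariant_functions N U)"
  unfolding coefficient_closed_def
proof
  fix f assume f: "f \<in> invariant_functions N U"
  then have "f \<in> polynomial_functions scale" by (simp add: invariant_functions_def)
  from this subalgebra_polynomial_functions
  have "\<exists>p n. expansion (\<lambda>v t. f (0 + t *s v)) p n \<and>
      (\<forall>i. (\<lambda>v. coeff (p v) i) \<in> polynomial_functions scale)"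
    by (rule polynomial_function_expansion) (auto intro: polynomial_functions.intros)
  then obtain p n where p: "expansion (\<lambda>v t. f (t *s v)) p n"
      "\<And>i. (\<lambda>v. coeff (p v) i) \<in> polynomial_functions scale" by auto
  have "p (\<sigma> v) = p v" if "\<sigma> \<in> N" for \<sigma> v
    using f that by (intro expansion_unique[OF p(1)]) (simp add: invariant_functions_def flip: N)
  moreover have "p (v + k) = p v" if "k \<in> U" for k v
    using f that subspace_scale[OF U that]
    by (intro expansion_unique[OF p(1)]) (simp add: invariant_functions_def scale_right_distrib)
  ultimately show "\<exists>p n. expansion (\<lambda>v t. f (t *s v)) p n \<and> (\<forall>i. (\<lambda>v. coeff (p v) i) \<in> invariant_functions N U)"
    using p by (intro exI[of _ p] exI[of _ n]) (simp add: invariant_functions_def)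
qed

definition homogeneous :: "nat \<Rightarrow> ('v \<Rightarrow> 'f) \<Rightarrow> bool" where
  "homogeneous d f \<longleftrightarrow> (\<forall>v t. f (t *s v) = t ^ d * f v)"

lemma homogeneous_component:
  assumes p: "expansion (\<lambda>v t. f (t *s v)) p n"
  shows "homogeneous d (\<lambda>v. coeff (p v) d)"
  unfolding homogeneous_def
proof (intro allI)
  fix v t
  have "p (t *s v) = p v \<circ>\<^sub>p [:0, t:]"
    using p by (intro poly_eqI_nonzero) (simp add: expansion_def poly_pcompose mult.commute)
  then show "coeff (p (t *s v)) d = t ^ d * coeff (p v) d"
    by (simp add: coeff_pcompose_linear)
qed

lemma sum_homogeneous_components:
  assumes p: "expansion (\<lambda>v t. f (t *s v)) p n"
  shows "f v = (\<Sum>d\<le>n. coeff (p v) d)"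
proof -
  have "f v = poly (p v) 1" using p by (simp add: expansion_def)
  also have "\<dots> = (\<Sum>d\<le>n. coeff (p v) d)"
    unfolding poly_altdef using p
    by (subst sum.mono_neutral_left[of "{..n}"]) (auto simp: expansion_def coeff_eq_0)
  finally show ?thesis .
qed

text \<open>
  For \<open>t \<noteq> 0\<close> one has \<open>f (v + t e) = t ^ d * f (e + v / t)\<close>, so the polynomial in \<open>t\<close> on the left is
  the reversal, with respect to \<open>d\<close>, of the expansion of \<open>f\<close> at \<open>e\<close> in the direction \<open>v\<close>.
\<close>

lemma homogeneous_expansion:
  assumes f: "f \<in> polynomial_functions scale" "homogeneous d f"
  shows "\<exists>p. expansion (\<lambda>v t. f (v + t *s e)) p d \<and> (\<forall>v. coeff (p v) d = f e)"
proof -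
  obtain p n where p: "expansion (\<lambda>v t. f (v + t *s e)) p n"
    using coefficient_closed_translation[of "{}" e "{}"] f(1)
    unfolding coefficient_closed_def invariant_functions_def by auto
  from f(1) subalgebra_polynomial_functions
  have "\<exists>p n. expansion (\<lambda>v t. f (e + t *s v)) p n \<and>
      (\<forall>i. (\<lambda>v. coeff (p v) i) \<in> polynomial_functions scale)"
    by (rule polynomial_function_expansion) (auto intro: polynomial_functions.intros)
  then obtain r m where r: "expansion (\<lambda>v t. f (e + t *s v)) r m" by auto
  have coeff_p: "coeff (p v) i = (if i \<le> d then coeff (r v) (d - i) else 0)" for v i
  proof -
    \<comment> \<open>\<open>r'\<close> is the reversal \<open>t ^ m * r (1 / t)\<close>; the powers of \<open>t\<close> on both sides clear denominators
      without comparing \<open>m\<close> and \<open>d\<close>.\<close>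
    define r' where "r' = (\<Sum>i\<le>m. monom (coeff (r v) i) (m - i))"
    have "monom 1 m * p v = monom 1 d * r'"
    proof (rule poly_eqI_nonzero)
      fix t :: 'f assume t: "t \<noteq> 0"
      have "poly r' t = (\<Sum>i\<le>m. coeff (r v) i * t ^ (m - i))"
        by (simp add: r'_def poly_sum poly_monom)
      also have "\<dots> = t ^ m * (\<Sum>i\<le>m. coeff (r v) i * inverse t ^ i)"
        using t by (simp add: sum_distrib_left power_diff field_simps)
      also have "(\<Sum>i\<le>m. coeff (r v) i * inverse t ^ i) = poly (r v) (inverse t)"
        unfolding poly_altdef using r
        by (subst sum.mono_neutral_right[of "{..m}"]) (auto simp: expansion_def coeff_eq_0)
      also have "\<dots> = f (inverse t *s (v + t *s e))"
        using r t by (simp add: expansion_def scale_right_distrib add.commute)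
      finally have "t ^ d * poly r' t = t ^ m * (t ^ d * f (inverse t *s (v + t *s e)))"
        by (simp add: mult.left_commute)
      also have "t ^ d * f (inverse t *s (v + t *s e)) = f (t *s inverse t *s (v + t *s e))"
        using f(2) unfolding homogeneous_def by metis
      also have "\<dots> = poly (p v) t" using p t by (simp add: expansion_def)
      finally show "poly (monom 1 m * p v) t = poly (monom 1 d * r') t"
        by (simp add: poly_monom)
    qed
    then have "coeff (monom 1 m * p v) (m + i) = coeff (monom 1 d * r') (m + i)" by simp
    then have "coeff (p v) i = (if d \<le> m + i then coeff r' (m + i - d) else 0)"
      by (simp add: coeff_monom_mult)
    moreover have "coeff r' j = (if j \<le> m then coeff (r v) (m - j) else 0)" for j
    proof -
      have "coeff r' j = (\<Sum>i\<le>m. if m - i = j then coeff (r v) i else 0)"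
        by (simp add: r'_def coeff_sum)
      also have "\<dots> = (\<Sum>i\<in>(if j \<le> m then {m - j} else {}). coeff (r v) i)"
        by (intro sum.mono_neutral_cong_right) (auto split: if_splits)
      finally show ?thesis by simp
    qed
    moreover have "coeff (r v) k = 0" if "k > m" for k
      using r that by (intro coeff_eq_0) (metis expansion_def le_less_trans)
    ultimately show ?thesis by (auto simp: not_le)
  qed
  have "coeff (r v) 0 = f e" for v
  proof -
    have "coeff (r v) 0 = poly (r v) 0" by (simp add: poly_0_coeff_0)
    then show ?thesis using r by (simp add: expansion_def)
  qed
  then show ?thesis using p coeff_p
    by (intro exI[of _ p]) (auto simp: expansion_def intro!: degree_le)
qed

text \<open>
  Monic up to a constant unit \<open>c\<close> that is the same for all lines parallel to \<open>e\<close>. The case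
  \<open>q = 0\<close> of a nonzero constant \<open>g\<close> is included.
\<close>

definition monic_along :: "'v \<Rightarrow> ('v \<Rightarrow> 'f) \<Rightarrow> bool" where
  "monic_along e g \<longleftrightarrow> (\<exists>p q c. expansion (\<lambda>v t. g (v + t *s e)) p q \<and> c \<noteq> 0 \<and> (\<forall>v. coeff (p v) q = c))"

lemma monic_along_homogeneous:
  assumes "f \<in> polynomial_functions scale" "homogeneous d f" "f e \<noteq> 0" "d > 0 \<or> a = 0"
  shows "monic_along e (\<lambda>v. f v - a)"
proof -
  obtain p where p: "expansion (\<lambda>v t. f (v + t *s e)) p d" "\<And>v. coeff (p v) d = f e"
    using homogeneous_expansion[OF assms(1,2)] by blast
  have "expansion (\<lambda>v t. f (v + t *s e) - a) (\<lambda>v. p v - [:a:]) d"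
    using p(1) by (auto simp: expansion_def intro!: degree_diff_le)
  moreover have "coeff (p v - [:a:]) d = f e" for v
    using p(2) assms(4) by (auto simp: coeff_pCons split: nat.split)
  ultimately show ?thesis unfolding monic_along_def using assms(3)
    by (intro exI[of _ "\<lambda>v. p v - [:a:]"] exI[of _ d] exI[of _ "f e"]) simp
qed

text \<open>
  Think of \<open>U\<close> as the kernel of a projection. Zeros of the eliminated ideal in the quotient by \<open>U\<close>
  lift to zeros of \<open>J\<close>, and the zero set of \<open>J\<close> has finite fibres over the quotient. Both properties
  together say that the zero set of \<open>J\<close> projects onto that of the eliminated ideal by a
  quasi-finite map.
\<close>

definition lifts_zeros :: "('v \<Rightarrow> 'v) set \<Rightarrow> 'v set \<Rightarrow> ('v \<Rightarrow> 'f) set \<Rightarrow> bool" where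
  "lifts_zeros N U J \<longleftrightarrow>
     (\<forall>w. (\<forall>f\<in>J \<inter> invariant_functions N U. f w = 0) \<longrightarrow> (\<exists>k\<in>U. \<forall>f\<in>J. f (w + k) = 0)) \<and>
     (\<forall>w. finite {k \<in> U. \<forall>f\<in>J. f (w + k) = 0})"

text \<open>
  An element of \<open>span (insert e U)\<close> is \<open>t e\<close> plus an element of \<open>U\<close>. The elimination step finds
  the zero \<open>w + t e\<close> of the part of \<open>J\<close> that is constant along \<open>U\<close>, and the hypothesis on \<open>U\<close>
  lifts it further. For the finiteness, \<open>g\<close> is constant along \<open>U\<close>, so \<open>t\<close> must be one of the
  finitely many roots of \<open>g\<close> on the line of \<open>w\<close>.
\<close>

lemma lifts_zeros_span_insert:
  assumes N: "\<And>\<sigma> v t. \<sigma> \<in> N \<Longrightarrow> \<sigma> (v + t *s e) = \<sigma> v + t *s e"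
    and U: "subspace U" and J: "ideal_of_functions (invariant_functions N {0}) J"
    and g: "g \<in> J" "g \<in> invariant_functions N U" "monic_along e g"
    and lifts: "lifts_zeros N U J"
  shows "lifts_zeros N (span (insert e U)) J"
proof -
  let ?R = "invariant_functions N U"
  obtain p q c where p: "expansion (\<lambda>v t. g (v + t *s e)) p q"
      and c: "c \<noteq> 0" "\<And>v. coeff (p v) q = c"
    using g(3) unfolding monic_along_def by blast
  have closed: "coefficient_closed (\<lambda>v t. v + t *s e) ?R"
    by (rule coefficient_closed_translation[OF N])
  obtain p' n where p': "expansion (\<lambda>v t. g (v + t *s e)) p' n" "\<And>i. (\<lambda>v. coeff (p' v) i) \<in> ?R"
    using closed g(2) unfolding coefficient_closed_def by blast
  have "p v = p' v" for v
    using p p'(1) by (intro poly_eqI_nonzero) (simp add: expansion_def)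
  then have p_R: "(\<lambda>v. coeff (p v) i) \<in> ?R" for i using p'(2) by simp
  have span_U: "k \<in> span (insert e U) \<longleftrightarrow> (\<exists>t. k - t *s e \<in> U)" for k
    using U by (simp add: span_breakdown_eq span_eq_iff[THEN iffD2])
  have J': "ideal_of_functions ?R (J \<inter> ?R)"
  proof -
    have "?R \<subseteq> invariant_functions N {0}" by (auto simp: invariant_functions_def)
    then show ?thesis
      using J g subalgebra_invariant_functions[of N U]
      unfolding ideal_of_functions_def subalgebra_of_functions_def by blast
  qed
  show ?thesis unfolding lifts_zeros_def
  proof (intro conjI allI impI)
    fix w assume w: "\<forall>f\<in>J \<inter> invariant_functions N (span (insert e U)). f w = 0"
    have "\<exists>t. \<forall>f\<in>J \<inter> ?R. f (w + t *s e) = 0"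
    proof (rule eliminate_one_direction[OF _ _ subalgebra_invariant_functions closed J' _ p p_R c])
      fix f assume f: "f \<in> J \<inter> ?R" and inv: "\<And>v t. f (v + t *s e) = f v"
      have "f (v + k) = f v" if k: "k \<in> span (insert e U)" for v k
      proof -
        obtain t where "k - t *s e \<in> U" using k span_U[of k] by auto
        then have "f ((v + t *s e) + (k - t *s e)) = f (v + t *s e)"
          using f unfolding invariant_functions_def by blast
        also have "\<dots> = f v" by (rule inv)
        finally show ?thesis by (simp add: add.assoc)
      qed
      then show "f w = 0" using f w by (simp add: invariant_functions_def)
    qed (use g in \<open>simp_all add: scale_left_distrib add.assoc\<close>)
    then obtain t where "\<forall>f\<in>J \<inter> ?R. f (w + t *s e) = 0" by blast
    then have "\<exists>k\<in>U. \<forall>f\<in>J. f (w + t *s e + k) = 0"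
      using lifts unfolding lifts_zeros_def by simp
    then obtain k where "k \<in> U" "\<forall>f\<in>J. f (w + t *s e + k) = 0" by auto
    then show "\<exists>k\<in>span (insert e U). \<forall>f\<in>J. f (w + k) = 0"
      by (intro bexI[of _ "t *s e + k"]) (auto simp: span_U add.assoc intro!: exI[of _ t])
  next
    fix w
    have "p w \<noteq> 0" using c by (metis coeff_0)
    then have "finite (\<Union>t\<in>{t. poly (p w) t = 0}.
        (\<lambda>k. t *s e + k) ` {k \<in> U. \<forall>f\<in>J. f (w + t *s e + k) = 0})"
      using lifts poly_roots_finite unfolding lifts_zeros_def by (intro finite_UN_I finite_imageI) auto
    moreover have "{k \<in> span (insert e U). \<forall>f\<in>J. f (w + k) = 0} \<subseteq> (\<Union>t\<in>{t. poly (p w) t = 0}.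
        (\<lambda>k. t *s e + k) ` {k \<in> U. \<forall>f\<in>J. f (w + t *s e + k) = 0})"
    proof clarify
      fix k assume "k \<in> span (insert e U)" and k: "\<forall>f\<in>J. f (w + k) = 0"
      then obtain t where t: "k - t *s e \<in> U" using span_U[of k] by auto
      have "poly (p w) t = g (w + t *s e)" using p by (simp add: expansion_def)
      also have "\<dots> = g ((w + t *s e) + (k - t *s e))"
        using g(2) t unfolding invariant_functions_def by (intro sym[of "g (w + t *s e + _)"]) blast
      also have "\<dots> = 0" using k g(1) by (simp add: add.assoc)
      finally show "k \<in> (\<Union>t\<in>{t. poly (p w) t = 0}.
        (\<lambda>k. t *s e + k) ` {k \<in> U. \<forall>f\<in>J. f (w + t *s e + k) = 0})"
        using t k by (intro UN_I[of t] image_eqI[of _ _ "k - t *s e"]) (simp_all add: add.assoc)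
    qed
    ultimately show "finite {k \<in> span (insert e U). \<forall>f\<in>J. f (w + k) = 0}"
      by (rule rev_finite_subset)
  qed
qed

text \<open>
  The family \<open>\<J>\<close> of ideals is treated simultaneously because the function required by \<open>monic\<close> for
  one member of the family may have to be found by lifting zeros of another member.
\<close>

lemma lifts_zeros_span:
  assumes "finite B"
    and N: "\<And>\<sigma> v k. \<sigma> \<in> N \<Longrightarrow> k \<in> span B \<Longrightarrow> \<sigma> (v + k) = \<sigma> v + k"
    and ideal: "\<And>J. J \<in> \<J> \<Longrightarrow> ideal_of_functions (invariant_functions N {0}) J"
    and monic: "\<And>U e J. subspace U \<Longrightarrow> U \<subseteq> span B \<Longrightarrow> e \<in> span B \<Longrightarrow> e \<notin> U \<Longrightarrow>
      (\<And>J. J \<in> \<J> \<Longrightarrow> lifts_zeros N U J) \<Longrightarrow> J \<in> \<J> \<Longrightarrow> \<exists>g\<in>J \<inter> invariant_functions N U. monic_along e g"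
    and "J \<in> \<J>"
  shows "lifts_zeros N (span B) J"
proof -
  have "\<forall>J\<in>\<J>. lifts_zeros N (span A) J" if "A \<subseteq> B" for A
    using finite_subset[OF that \<open>finite B\<close>] that
  proof (induction A rule: finite_induct)
    case empty
    have "J \<inter> invariant_functions N {0} = J" if "J \<in> \<J>" for J
      using ideal[OF that] by (auto simp: ideal_of_functions_def)
    then show ?case by (simp add: lifts_zeros_def)
  next
    case (insert e A)
    then have IH: "\<And>J. J \<in> \<J> \<Longrightarrow> lifts_zeros N (span A) J" by blast
    show ?case
    proof (cases "e \<in> span A")
      case True
      then show ?thesis using IH by (simp add: span_redundant)
    next
      case False
      have e: "e \<in> span B" using insert.prems by (simp add: span_base)
      have A: "span A \<subseteq> span B" using insert.prems by (intro span_mono) simp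
      have "lifts_zeros N (span (insert e (span A))) J" if J: "J \<in> \<J>" for J
      proof -
        obtain g where "g \<in> J" "g \<in> invariant_functions N (span A)" "monic_along e g"
          using monic[OF subspace_span A e False IH J] by blast
        then show ?thesis
          using N span_scale[OF e] by (intro lifts_zeros_span_insert ideal IH J) simp_all
      qed
      moreover have "span (insert e (span A)) = span (insert e A)"
        by (simp add: set_eq_iff span_breakdown_eq span_span)
      ultimately show ?thesis by simp
    qed
  qed
  then show ?thesis using \<open>J \<in> \<J>\<close> by blast
qed

end

section \<open>Finite fibres and lifting\<close>

lemma polynomial_functions_compose_linear:
  assumes \<phi>: "Vector_Spaces.linear s1 s2 \<phi>" and f: "f \<in> polynomial_functions s2"
  shows "(\<lambda>v. f (\<phi> v)) \<in> polynomial_functions s1"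
  using f
proof induction
  case (dual l)
  have "Vector_Spaces.linear s1 (*) (l \<circ> \<phi>)" by (rule Vector_Spaces.linear_compose[OF \<phi> dual])
  then show ?case using polynomial_functions.dual by (fastforce simp: o_def)
qed (auto intro: polynomial_functions.intros)

context alg_closed_vector_space
begin


lemma positive_degree_component:
  assumes p: "expansion (\<lambda>v t. f (t *s v)) p n" and "f e \<noteq> f 0"
  shows "\<exists>d>0. coeff (p e) d \<noteq> 0"
proof -
  have "(\<Sum>d\<le>n. coeff (p e) d) \<noteq> (\<Sum>d\<le>n. coeff (p 0) d)"
    using assms(2) by (simp flip: sum_homogeneous_components[OF p])
  then obtain d where d: "coeff (p e) d \<noteq> coeff (p 0) d" by (meson sum.cong)
  have "coeff (p (0 *s e)) d = 0 ^ d * coeff (p e) d"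
    using homogeneous_component[OF p, of d] unfolding homogeneous_def by blast
  then show ?thesis using d by (cases "d = 0") (auto intro!: exI[of _ d])
qed

text \<open>
  Let \<open>J\<close> be the ideal of functions on \<open>V \<times> F\<close> that vanish on the cone over \<open>Z \<times> {1}\<close>, with \<open>Z\<close> the
  fibre in question. Homogenizing the equations of \<open>Z\<close> shows that \<open>J\<close> has no nonzero zeros in the
  hyperplane \<open>span B \<times> {0}\<close> at infinity. Consequently all directions of this hyperplane can be
  eliminated: a direction \<open>e\<close> at which all eliminated functions vanish would lift to such a zero.
  The finiteness part of the elimination, applied to the point \<open>(0, 1)\<close>, bounds \<open>Z\<close>.
\<close>

lemma finite_fibre_of_homogeneous_functions:
  assumes "finite B"
    and \<F>: "\<And>f. f \<in> \<F> \<Longrightarrow> f \<in> polynomial_functions scale \<and> (\<exists>d>0. homogeneous d f)"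
    and nonzero: "\<And>k. k \<in> span B \<Longrightarrow> k \<noteq> 0 \<Longrightarrow> \<exists>f\<in>\<F>. f k \<noteq> 0"
  shows "finite {z \<in> span B. \<forall>f\<in>\<F>. f z = f z0}"
proof -
  define Z where "Z = {z \<in> span B. \<forall>f\<in>\<F>. f z = f z0}"
  define cone_scale where "cone_scale = (\<lambda>(c::'f) (x::'v \<times> 'f). (c *s fst x, c * snd x))"
  interpret X: alg_closed_vector_space cone_scale
    by unfold_locales
       (auto simp: cone_scale_def scale_left_distrib scale_right_distrib distrib_left distrib_right)
  have fst: "Vector_Spaces.linear cone_scale scale fst" and snd: "Vector_Spaces.linear cone_scale (*) snd"
    and embed: "Vector_Spaces.linear scale cone_scale (\<lambda>v. (v, 0))"
    by unfold_locales (auto simp: cone_scale_def algebra_simps)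
  interpret embed: Vector_Spaces.linear scale cone_scale "\<lambda>v. (v, 0)" by (rule embed)
  define J where "J = {\<Phi> \<in> polynomial_functions cone_scale. \<forall>z\<in>Z. \<forall>s. \<Phi> (s *s z, s) = 0}"
  have PF: "subalgebra_of_functions (polynomial_functions cone_scale)"
    by (rule subalgebra_polynomial_functions)
  have inv0: "X.invariant_functions {} {0} = polynomial_functions cone_scale"
    by (auto simp: X.invariant_functions_def)
  let ?B = "(\<lambda>b. (b, 0)) ` B"
  have span: "X.span ?B = (\<lambda>v. (v, 0)) ` span B" by (rule embed.span_image)
  have "X.lifts_zeros {} (X.span ?B) J"
  proof (rule X.lifts_zeros_span[where \<J> = "{J}"])
    show "finite ?B" using \<open>finite B\<close> by auto
  next
    fix J' assume "J' \<in> {J}"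
    then show "ideal_of_functions (X.invariant_functions {} {0}) J'"
      unfolding inv0 using PF subalgebra_const[OF PF, of 0]
      by (auto simp: ideal_of_functions_def subalgebra_of_functions_def J_def)
  next
    fix U e J'
    assume U: "X.subspace U" "U \<subseteq> X.span ?B" and e: "e \<in> X.span ?B" "e \<notin> U"
      and lifts: "\<And>J'. J' \<in> {J} \<Longrightarrow> X.lifts_zeros {} U J'" and J': "J' \<in> {J}"
    have "\<exists>\<Phi>\<in>J \<inter> X.invariant_functions {} U. \<Phi> e \<noteq> 0"
    proof (rule ccontr)
      assume "\<not> ?thesis"
      then have "\<forall>\<Phi>\<in>J \<inter> X.invariant_functions {} U. \<Phi> e = 0" by blast
      then have "\<exists>k\<in>U. \<forall>\<Phi>\<in>J. \<Phi> (e + k) = 0"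
        using lifts[of J] unfolding X.lifts_zeros_def by blast
      then obtain k where k: "k \<in> U" and zero: "\<And>\<Phi>. \<Phi> \<in> J \<Longrightarrow> \<Phi> (e + k) = 0" by auto
      have "e + k \<in> X.span ?B" using e k U by (intro X.span_add) auto
      then have "e + k \<in> (\<lambda>v. (v, 0)) ` span B" by (simp only: span)
      then obtain \<kappa> where \<kappa>: "\<kappa> \<in> span B" "e + k = (\<kappa>, 0)" by (elim imageE) simp
      have "\<kappa> \<noteq> 0"
      proof
        assume "\<kappa> = 0"
        then have "e + k = 0" unfolding \<kappa>(2) by (simp only: zero_prod_def)
        then have "e = - k" by (rule eq_neg_iff_add_eq_0[THEN iffD2])
        then have "e \<in> U" using X.subspace_neg[OF U(1) k] by (simp only:)
        then show False using e(2) by contradiction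
      qed
      then obtain f where f: "f \<in> \<F>" "f \<kappa> \<noteq> 0" using nonzero[OF \<kappa>(1)] by auto
      obtain d where d: "d > 0" "homogeneous d f" using \<F>[OF f(1)] by auto
      \<comment> \<open>The homogenization of the equation \<open>f z = f z0\<close>.\<close>
      let ?\<Phi> = "\<lambda>x. f (fst x) + (- f z0) * (\<Prod>i<d. snd x)"
      have "?\<Phi> \<in> polynomial_functions cone_scale"
        using \<F>[OF f(1)] polynomial_functions.dual[OF snd]
        by (intro subalgebra_add[OF PF] subalgebra_mult[OF PF] subalgebra_const[OF PF]
              subalgebra_prod[OF PF] polynomial_functions_compose_linear[OF fst]) auto
      then have "?\<Phi> \<in> J"
        using f(1) d(2) by (auto simp: J_def Z_def homogeneous_def)
      then have "?\<Phi> (e + k) = 0" by (rule zero)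
      then show False using f(2) d(1) \<kappa>(2) by simp
    qed
    then obtain \<Phi> where \<Phi>: "\<Phi> \<in> J" "\<Phi> \<in> X.invariant_functions {} U" "\<Phi> e \<noteq> 0" by auto
    have "coefficient_closed (\<lambda>v t. cone_scale t v) (X.invariant_functions {} U)"
      using U(1) by (intro X.coefficient_closed_scaling) auto
    then obtain p n where p: "expansion (\<lambda>v t. \<Phi> (cone_scale t v)) p n"
        and coeffs: "\<And>i. (\<lambda>v. coeff (p v) i) \<in> X.invariant_functions {} U"
      using \<Phi>(2) unfolding coefficient_closed_def by auto
    have "(\<Sum>d\<le>n. coeff (p e) d) \<noteq> 0"
      using \<Phi>(3) X.sum_homogeneous_components[OF p, of e] by simp
    then obtain d where d: "coeff (p e) d \<noteq> 0" by (meson sum.neutral)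
    have "p (s *s z, s) = 0" if z: "z \<in> Z" for s z
    proof (rule poly_eqI_nonzero)
      fix t
      have "poly (p (s *s z, s)) t = \<Phi> ((t * s) *s z, t * s)"
        using p by (simp add: expansion_def cone_scale_def)
      then show "poly (p (s *s z, s)) t = poly 0 t" using \<Phi>(1) z by (simp add: J_def)
    qed
    then have "(\<lambda>v. coeff (p v) d) \<in> J"
      using coeffs[of d] by (auto simp: J_def X.invariant_functions_def)
    moreover have "X.monic_along e (\<lambda>v. coeff (p v) d - 0)"
      using coeffs[of d] X.homogeneous_component[OF p] d
      by (intro X.monic_along_homogeneous) (auto simp: X.invariant_functions_def)
    ultimately show "\<exists>g\<in>J' \<inter> X.invariant_functions {} U. X.monic_along e g"
      using coeffs[of d] J' by auto
  qed auto
  then have "finite {k \<in> X.span ?B. \<forall>\<Phi>\<in>J. \<Phi> ((0, 1) + k) = 0}"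
    by (simp add: X.lifts_zeros_def)
  moreover have "(\<lambda>z. (z, 0)) ` Z \<subseteq> {k \<in> X.span ?B. \<forall>\<Phi>\<in>J. \<Phi> ((0, 1) + k) = 0}"
    unfolding span by (auto simp: Z_def J_def dest!: bspec[where x = 1] spec[where x = 1])
  ultimately have "finite ((\<lambda>z. (z, 0 :: 'f)) ` Z)" by (rule rev_finite_subset)
  then have "finite Z" by (rule finite_imageD) (auto simp: inj_on_def)
  then show ?thesis by (simp add: Z_def)
qed

text \<open>
  Elimination is applied to the vanishing ideals \<open>J x\<close> of all points \<open>x\<close> in the algebra of
  \<open>N\<close>-invariants. If some direction \<open>e\<close> could not be eliminated, all eliminated functions would take
  the same value at \<open>e\<close> and \<open>0\<close>; lifting \<open>0\<close> to a zero \<open>k\<close> of \<open>J e\<close> and translating by \<open>- k\<close> would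
  then contradict \<open>sep\<close> at \<open>e - k\<close>.
\<close>

lemma lift_along_pointwise_fixed_subspace:
  assumes "finite B"
    and linear: "\<And>\<sigma>. \<sigma> \<in> N \<Longrightarrow> Vector_Spaces.linear scale scale \<sigma>"
    and fixed: "\<And>\<sigma> k. \<sigma> \<in> N \<Longrightarrow> k \<in> span B \<Longrightarrow> \<sigma> k = k"
    and sep: "\<And>k. k \<in> span B \<Longrightarrow> k \<noteq> 0 \<Longrightarrow> \<exists>f\<in>invariant_functions N {0}. f k \<noteq> f 0"
    and agree: "\<And>f. f \<in> invariant_functions N (span B) \<Longrightarrow> f u = f w"
  shows "\<exists>k\<in>span B. \<forall>f\<in>invariant_functions N {0}. f (w + k) = f u"
proof -
  let ?R = "invariant_functions N {0}"
  define J where "J x = {f \<in> ?R. f x = 0}" for x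
  have R: "subalgebra_of_functions (invariant_functions N U)" for U
    by (rule subalgebra_invariant_functions)
  have mono: "invariant_functions N U \<subseteq> ?R" for U by (auto simp: invariant_functions_def)
  have shift_const: "(\<lambda>v. f v - c) \<in> invariant_functions N U"
    if "f \<in> invariant_functions N U" for f c U
    using subalgebra_add[OF R that subalgebra_const[OF R, of "- c"]] by simp
  have N_add: "\<sigma> (v + k) = \<sigma> v + k" if "\<sigma> \<in> N" "k \<in> span B" for \<sigma> v k
  proof -
    interpret \<sigma>: Vector_Spaces.linear scale scale \<sigma> by (rule linear[OF that(1)])
    show ?thesis using that by (simp add: \<sigma>.add fixed)
  qed
  have N_scale: "\<sigma> (t *s v) = t *s \<sigma> v" if "\<sigma> \<in> N" for \<sigma> t v
  proof -
    interpret \<sigma>: Vector_Spaces.linear scale scale \<sigma> by (rule linear[OF that])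
    show ?thesis by (rule \<sigma>.scale)
  qed
  have translate: "(\<lambda>v. f (v + k)) \<in> ?R" if f: "f \<in> ?R" and k: "k \<in> span B" for f k
  proof -
    have "coefficient_closed (\<lambda>v t. v + t *s k) ?R"
      using N_add span_scale[OF k] by (intro coefficient_closed_translation) simp
    then obtain p n where p: "expansion (\<lambda>v t. f (v + t *s k)) p n" "\<And>i. (\<lambda>v. coeff (p v) i) \<in> ?R"
      using f unfolding coefficient_closed_def by auto
    have "f (v + k) = (\<Sum>i\<le>n. coeff (p v) i)" for v
    proof -
      have "f (v + k) = poly (p v) 1" using p(1) by (simp add: expansion_def)
      also have "\<dots> = (\<Sum>i\<le>n. coeff (p v) i)"
        unfolding poly_altdef using p(1)
        by (subst sum.mono_neutral_left[of "{..n}"]) (auto simp: expansion_def coeff_eq_0)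
      finally show ?thesis .
    qed
    then show ?thesis using subalgebra_sum[OF R, of "{..n}" "\<lambda>i v. coeff (p v) i"] p(2) by simp
  qed
  have "lifts_zeros N (span B) (J u)"
  proof (rule lifts_zeros_span[where \<J> = "range J"])
    fix J' assume "J' \<in> range J"
    then show "ideal_of_functions ?R J'"
      using R[of "{0}"] subalgebra_const[OF R[of "{0}"], of 0]
      by (auto simp: ideal_of_functions_def subalgebra_of_functions_def J_def)
  next
    fix U e J'
    assume U: "subspace U" "U \<subseteq> span B" and e: "e \<in> span B" "e \<notin> U"
      and lifts: "\<And>J'. J' \<in> range J \<Longrightarrow> lifts_zeros N U J'" and J': "J' \<in> range J"
    have "\<exists>f\<in>invariant_functions N U. f e \<noteq> f 0"
    proof (rule ccontr)
      assume "\<not> ?thesis"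
      then have "\<forall>f\<in>J e \<inter> invariant_functions N U. f 0 = 0" by (auto simp: J_def)
      then have "\<exists>k\<in>U. \<forall>f\<in>J e. f (0 + k) = 0"
        using lifts[of "J e"] unfolding lifts_zeros_def by blast
      then obtain k where k: "k \<in> U" and zero: "\<And>f. f \<in> J e \<Longrightarrow> f k = 0" by auto
      have eq: "f k = f e" if "f \<in> ?R" for f
        using zero[of "\<lambda>v. f v - f e"] shift_const[OF that] by (simp add: J_def)
      have k': "k \<in> span B" using k U by auto
      have "f (e - k) = f 0" if f: "f \<in> ?R" for f
        using eq[OF translate[OF f span_neg[OF k']]] by simp
      moreover have "e - k \<in> span B" "e - k \<noteq> 0" using e k k' by (auto intro: span_diff)
      ultimately show False using sep by blast
    qed
    then obtain f where f: "f \<in> invariant_functions N U" "f e \<noteq> f 0" by auto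
    have "coefficient_closed (\<lambda>v t. t *s v) (invariant_functions N U)"
      using U(1) N_scale by (intro coefficient_closed_scaling) auto
    then obtain p n where p: "expansion (\<lambda>v t. f (t *s v)) p n"
        and coeffs: "\<And>i. (\<lambda>v. coeff (p v) i) \<in> invariant_functions N U"
      using f(1) unfolding coefficient_closed_def by auto
    have hom: "homogeneous d (\<lambda>v. coeff (p v) d)" for d by (rule homogeneous_component[OF p])
    \<comment> \<open>Positive degree is essential: subtracting the value at \<open>x\<close> must not affect the leading term.\<close>
    obtain d where d_pos: "d > 0" and nz: "coeff (p e) d \<noteq> 0"
      using positive_degree_component[OF p f(2)] by auto
    obtain x where x: "J' = J x" using J' by auto
    have "(\<lambda>v. coeff (p v) d - coeff (p x) d) \<in> J x \<inter> invariant_functions N U"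
      using shift_const[OF coeffs, of d] mono[of U] by (auto simp: J_def)
    moreover have "monic_along e (\<lambda>v. coeff (p v) d - coeff (p x) d)"
      using coeffs[of d] hom nz d_pos
      by (intro monic_along_homogeneous) (auto simp: invariant_functions_def)
    ultimately show "\<exists>g\<in>J' \<inter> invariant_functions N U. monic_along e g" unfolding x by blast
  qed (use \<open>finite B\<close> N_add in auto)
  moreover have "\<forall>f\<in>J u \<inter> invariant_functions N (span B). f w = 0"
  proof
    fix f assume "f \<in> J u \<inter> invariant_functions N (span B)"
    then show "f w = 0" using agree[of f] by (simp add: J_def)
  qed
  ultimately have "\<exists>k\<in>span B. \<forall>f\<in>J u. f (w + k) = 0" unfolding lifts_zeros_def by blast
  then obtain k where k: "k \<in> span B" and zero: "\<And>f. f \<in> J u \<Longrightarrow> f (w + k) = 0" by auto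
  have "f (w + k) = f u" if "f \<in> ?R" for f
    using zero[of "\<lambda>v. f v - f u"] shift_const[OF that] by (simp add: J_def)
  then show ?thesis using k by blast
qed

end

section \<open>Invariants of group representations\<close>

context G_module
begin

lemma action_linear:
  assumes "g \<in> carrier G"
  shows "\<rho> g (v + w) = \<rho> g v + \<rho> g w" "\<rho> g (s c v) = s c (\<rho> g v)" "\<rho> g 0 = 0"
proof -
  interpret l: Vector_Spaces.linear s s "\<rho> g" by (rule linear_action[OF assms])
  show "\<rho> g (v + w) = \<rho> g v + \<rho> g w" "\<rho> g (s c v) = s c (\<rho> g v)" "\<rho> g 0 = 0"
    by (rule l.add l.scale l.zero)+
qed

lemma group_G: "group G"
  using group_hom by (simp add: group_hom_def)

lemma action_mult:
  "g \<in> carrier G \<Longrightarrow> h \<in> carrier G \<Longrightarrow> \<rho> (g \<otimes>\<^bsub>G\<^esub> h) v = \<rho> g (\<rho> h v)"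
  by (rule composition_rule) auto

lemma action_inv [simp]:
  assumes "g \<in> carrier G"
  shows "\<rho> (inv\<^bsub>G\<^esub> g) (\<rho> g v) = v" "\<rho> g (\<rho> (inv\<^bsub>G\<^esub> g) v) = v"
proof -
  interpret group G by (rule group_G)
  show "\<rho> (inv\<^bsub>G\<^esub> g) (\<rho> g v) = v"
    using orbit_sym_aux[OF assms, of v] by simp
  show "\<rho> g (\<rho> (inv\<^bsub>G\<^esub> g) v) = v"
    using orbit_sym_aux[of "inv\<^bsub>G\<^esub> g" v] assms by simp
qed

lemma invariant_polynomials_iff:
  "f \<in> invariant_polynomials G s \<rho> \<longleftrightarrow>
     f \<in> polynomial_functions s \<and> (\<forall>g\<in>carrier G. \<forall>v. f (\<rho> g v) = f v)"
proof -
  interpret group G by (rule group_G)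
  show ?thesis unfolding invariant_polynomials_def
    by (auto simp: fun_eq_iff) (metis inv_closed inv_inv)+
qed

lemma orbit_eqD:
  assumes "orbit G \<rho> v = orbit G \<rho> w"
  obtains g where "g \<in> carrier G" "\<rho> g w = v"
proof -
  have "v \<in> orbit G \<rho> w" using orbit_refl[of v] assms by simp
  then show ?thesis using that by (auto simp: orbit_def)
qed

end

text \<open>
  The product is over the set of distinct translates, which \<open>G\<close> permutes; this replaces a product
  over cosets of a subgroup.
\<close>

lemma product_over_finite_translates:
  fixes s :: "'f::field \<Rightarrow> 'v::ab_group_add \<Rightarrow> 'v"
  assumes "G_module G s \<rho>"
    and f: "f \<in> polynomial_functions s" and fin: "finite ((\<lambda>g v. f (\<rho> g v)) ` carrier G)"
  shows "(\<lambda>v. \<Prod>h\<in>(\<lambda>g v. f (\<rho> g v)) ` carrier G. h v) \<in> invariant_polynomials G s \<rho>"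
proof -
  interpret G_module G s \<rho> by fact
  interpret group G by (rule group_G)
  let ?H = "(\<lambda>g v. f (\<rho> g v)) ` carrier G"
  have "(\<lambda>v. f (\<rho> g v)) \<in> polynomial_functions s" if "g \<in> carrier G" for g
    by (rule polynomial_functions_compose_linear[OF linear_action[OF that] f])
  then have "(\<lambda>v. \<Prod>h\<in>?H. h v) \<in> polynomial_functions s"
    by (intro subalgebra_prod[OF subalgebra_polynomial_functions]) auto
  moreover have "(\<Prod>h\<in>?H. h (\<rho> x v)) = (\<Prod>h\<in>?H. h v)" if x: "x \<in> carrier G" for x v
  proof (rule prod.reindex_bij_witness[of _ "\<lambda>h v. h (\<rho> (inv\<^bsub>G\<^esub> x) v)" "\<lambda>h v. h (\<rho> x v)"])
    fix h assume "h \<in> ?H"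
    then obtain g where g: "g \<in> carrier G" "h = (\<lambda>v. f (\<rho> g v))" by auto
    show "(\<lambda>v. h (\<rho> x v)) \<in> ?H"
      using g x by (intro image_eqI[of _ _ "g \<otimes>\<^bsub>G\<^esub> x"]) (auto simp: action_mult)
    show "(\<lambda>v. h (\<rho> (inv\<^bsub>G\<^esub> x) v)) \<in> ?H"
      using g x by (intro image_eqI[of _ _ "g \<otimes>\<^bsub>G\<^esub> inv\<^bsub>G\<^esub> x"]) (auto simp: action_mult)
  qed (use x in auto)
  ultimately show ?thesis unfolding invariant_polynomials_iff by blast
qed

text \<open>
  Every orbit is contained in a fibre of the homogeneous invariants.
\<close>

lemma finite_orbits_of_separated_submodule:
  fixes s :: "'f::alg_closed_field \<Rightarrow> 'v::ab_group_add \<Rightarrow> 'v"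
  assumes "G_module G s \<rho>" and "finite B"
    and stable: "\<And>g v. g \<in> carrier G \<Longrightarrow> v \<in> module.span s B \<Longrightarrow> \<rho> g v \<in> module.span s B"
    and sep: "\<And>k. k \<in> module.span s B \<Longrightarrow> k \<noteq> 0 \<Longrightarrow> \<exists>f\<in>invariant_polynomials G s \<rho>. f k \<noteq> f 0"
    and z: "z \<in> module.span s B"
  shows "finite (orbit G \<rho> z)"
proof -
  interpret G_module G s \<rho> by fact
  interpret alg_closed_vector_space s by unfold_locales
  let ?N = "\<rho> ` carrier G"
  have inv: "invariant_functions ?N {0} = invariant_polynomials G s \<rho>"
    by (auto simp: invariant_functions_def invariant_polynomials_iff)
  define \<F> where "\<F> = {f \<in> invariant_polynomials G s \<rho>. \<exists>d>0. homogeneous d f}"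
  have "finite {y \<in> span B. \<forall>f\<in>\<F>. f y = f z}"
  proof (rule finite_fibre_of_homogeneous_functions[OF \<open>finite B\<close>])
    fix k assume "k \<in> span B" "k \<noteq> 0"
    then obtain f where f: "f \<in> invariant_functions ?N {0}" "f k \<noteq> f 0" using sep inv by blast
    have "coefficient_closed (\<lambda>v t. s t v) (invariant_functions ?N {0})"
      by (rule coefficient_closed_scaling) (auto simp: action_linear subspace_0)
    then obtain p n where p: "expansion (\<lambda>v t. f (s t v)) p n"
        and coeffs: "\<And>i. (\<lambda>v. coeff (p v) i) \<in> invariant_functions ?N {0}"
      using f(1) unfolding coefficient_closed_def by auto
    obtain d where d: "d > 0" "coeff (p k) d \<noteq> 0"
      using positive_degree_component[OF p f(2)] by blast
    then show "\<exists>f\<in>\<F>. f k \<noteq> 0"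
      using coeffs[of d] homogeneous_component[OF p, of d] unfolding inv \<F>_def by auto
  qed (auto simp: \<F>_def invariant_polynomials_iff)
  moreover have "orbit G \<rho> z \<subseteq> {y \<in> span B. \<forall>f\<in>\<F>. f y = f z}"
    using stable z by (auto simp: orbit_def \<F>_def invariant_polynomials_iff)
  ultimately show ?thesis by (rule rev_finite_subset)
qed

theorem theorem1:
  fixes G :: "('g, 'm) monoid_scheme"
    and sV :: "'f::alg_closed_field \<Rightarrow> 'v::ab_group_add \<Rightarrow> 'v"
    and sW :: "'f \<Rightarrow> 'w::ab_group_add \<Rightarrow> 'w"
    and \<rho> :: "'g \<Rightarrow> 'v \<Rightarrow> 'v"
    and \<tau> :: "'g \<Rightarrow> 'w \<Rightarrow> 'w"
    and \<phi> :: "'v \<Rightarrow> 'w"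
    and S :: "('w \<Rightarrow> 'f) set"
    and T :: "('v \<Rightarrow> 'f) set"
  assumes "G_module G sV \<rho>"
    and "G_module G sW \<tau>"
    and "Vector_Spaces.linear sV sW \<phi>"
    and "G_equivariant G \<rho> \<tau> \<phi>"
    and "surj \<phi>"
    and "separating_set G sW \<tau> S"
    and "T \<subseteq> invariant_polynomials G sV \<rho>"
    and "\<And>v1 v2. orbit G \<rho> v1 \<noteq> orbit G \<rho> v2 \<Longrightarrow> \<phi> v1 = \<phi> v2 \<Longrightarrow> \<exists>f\<in>T. f v1 \<noteq> f v2"
  shows "separating_set G sV \<rho> (pullback \<phi> ` S \<union> T)"
proof -
  interpret V: G_module G sV \<rho> by fact
  interpret W: G_module G sW \<tau> by fact
  interpret \<phi>: Vector_Spaces.linear sV sW \<phi> by fact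
  interpret V: alg_closed_vector_space sV by unfold_locales
  interpret group G by (rule V.group_G)
  have equivariant: "\<phi> (\<rho> g v) = \<tau> g (\<phi> v)" if "g \<in> carrier G" for g v
    using assms(4) that by (simp add: G_equivariant_def)
  have S: "S \<subseteq> invariant_polynomials G sW \<tau>"
    and S_sep: "\<And>u w f. (\<And>f. f \<in> S \<Longrightarrow> f u = f w) \<Longrightarrow> f \<in> invariant_polynomials G sW \<tau> \<Longrightarrow> f u = f w"
    using assms(6) unfolding separating_set_def by blast+
  define K where "K = {v. \<phi> v = 0}"
  obtain B where B: "finite B" "V.span B = K"
  proof -
    obtain B0 where B0: "finite B0" "V.span B0 = UNIV" using V.finite_dim by blast
    obtain B where B: "B \<subseteq> K" "V.independent B" "K \<subseteq> V.span B"
      using V.maximal_independent_subset by blast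
    have "V.subspace K" by (auto simp: V.subspace_def K_def \<phi>.add \<phi>.scale)
    then have "V.span B = K" using B V.span_minimal by blast
    moreover have "finite B" using V.independent_span_bound[OF B0(1) B(2)] B0(2) by simp
    ultimately show thesis using that by blast
  qed
  have K_stable: "\<rho> g v \<in> K" if "g \<in> carrier G" "v \<in> K" for g v
    using that by (simp add: K_def equivariant W.action_linear)
  have orbit_0: "orbit G \<rho> 0 = {0}"
    using one_closed by (auto simp: orbit_def V.action_linear intro!: exI[of _ "\<one>\<^bsub>G\<^esub>"])
  have K_sep: "\<exists>f\<in>invariant_polynomials G sV \<rho>. f k \<noteq> f 0" if "k \<in> K" "k \<noteq> 0" for k
  proof -
    have "orbit G \<rho> k \<noteq> orbit G \<rho> 0" using V.orbit_refl[of k] that(2) orbit_0 by auto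
    then have "\<exists>f\<in>T. f k \<noteq> f 0" using assms(8) that(1) by (simp add: K_def)
    then show ?thesis using assms(7) by blast
  qed
  have finite_orbit: "finite (orbit G \<rho> k)" if "k \<in> K" for k
    using finite_orbits_of_separated_submodule[OF assms(1) B(1)] that K_stable K_sep unfolding B(2)
    by blast
  define N where "N = \<rho> ` {g \<in> carrier G. \<forall>k\<in>K. \<rho> g k = k}"
  \<comment> \<open>The restrictions of group elements to a basis of \<open>K\<close> stand for the cosets of the pointwise
    stabilizer of \<open>K\<close>, and the set \<open>A\<close> below consists of coset representatives.\<close>
  define restrict_to_B where "restrict_to_B g = restrict (\<rho> g) B" for g
  have B_sub: "B \<subseteq> K" using B(2) V.span_superset by blast
  have "finite (restrict_to_B ` carrier G)"
  proof (rule finite_subset)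
    show "restrict_to_B ` carrier G \<subseteq> (\<Pi>\<^sub>E b\<in>B. orbit G \<rho> b)"
      by (auto simp: restrict_to_B_def orbit_def)
    show "finite (\<Pi>\<^sub>E b\<in>B. orbit G \<rho> b)"
      using B(1) B_sub finite_orbit by (intro finite_PiE) auto
  qed
  then obtain A where A: "finite A" "A \<subseteq> carrier G" "restrict_to_B ` carrier G = restrict_to_B ` A"
    by (metis finite_subset_image subset_refl)
  let ?R = "V.invariant_functions N K"
  have same_translate: "f (\<rho> g v) = f (\<rho> h v)"
    if f: "f \<in> V.invariant_functions N U" and gh: "g \<in> carrier G" "h \<in> carrier G"
      and eq: "restrict_to_B g = restrict_to_B h" for f g h v U
  proof -
    have on_B: "\<rho> g b = \<rho> h b" if "b \<in> B" for b
      using fun_cong[OF eq, of b] that by (simp add: restrict_to_B_def)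
    have on_K: "\<rho> g k = \<rho> h k" if "k \<in> K" for k
    proof -
      have "k \<in> V.span B" using that B(2) by simp
      then show ?thesis
        by (induction rule: V.span_induct_alt)
           (auto simp: V.action_linear gh on_B)
    qed
    \<comment> \<open>The quotient is taken on the left, so that it acts after \<open>h\<close> and is absorbed by \<open>f\<close>.\<close>
    let ?n = "g \<otimes>\<^bsub>G\<^esub> inv\<^bsub>G\<^esub> h"
    have "\<rho> ?n k = k" if "k \<in> K" for k
      using gh that on_K[of "\<rho> (inv\<^bsub>G\<^esub> h) k"] K_stable[of "inv\<^bsub>G\<^esub> h" k] by (simp add: V.action_mult)
    then have "\<rho> ?n \<in> N" using gh by (auto simp: N_def)
    then have "f (\<rho> ?n (\<rho> h v)) = f (\<rho> h v)"
      using f by (simp add: V.invariant_functions_def)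
    then show ?thesis using gh by (simp add: V.action_mult)
  qed
  \<comment> \<open>An invariant that is constant along \<open>K\<close> factors through an invariant of \<open>W\<close>.\<close>
  have descend: "P u = P w"
    if P: "P \<in> invariant_polynomials G sV \<rho>" and P_K: "\<And>k v. k \<in> K \<Longrightarrow> P (v + k) = P v"
      and uw: "\<And>f. f \<in> S \<Longrightarrow> f (\<phi> u) = f (\<phi> w)" for P u w
  proof -
    obtain \<psi> where \<psi>: "Vector_Spaces.linear sW sV \<psi>" "\<And>x. \<phi> (\<psi> x) = x"
    proof -
      interpret vector_space_pair sV sW by unfold_locales
      have "\<exists>\<psi>. range \<psi> \<subseteq> V.span UNIV \<and> Vector_Spaces.linear sW sV \<psi> \<and>
          (\<forall>x\<in>W.span UNIV. \<phi> (\<psi> x) = x)"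
        by (rule linear_surj_right_inverse[OF assms(3)]) (use assms(5) in auto)
      then show thesis using that by (auto simp: W.span_UNIV)
    qed
    have P_eq: "P (\<psi> (\<phi> v)) = P v" for v
      using P_K[of "\<psi> (\<phi> v) - v" v] \<psi>(2) by (simp add: K_def \<phi>.diff)
    have "(\<lambda>x. P (\<psi> x)) \<in> invariant_polynomials G sW \<tau>"
    proof -
      have "P (\<psi> (\<tau> g x)) = P (\<psi> x)" if g: "g \<in> carrier G" for g x
      proof -
        have "\<tau> g x = \<phi> (\<rho> g (\<psi> x))" by (simp add: equivariant g \<psi>)
        then have "P (\<psi> (\<tau> g x)) = P (\<rho> g (\<psi> x))" by (simp add: P_eq)
        then show ?thesis using P g by (simp add: V.invariant_polynomials_iff)
      qed
      then show ?thesis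
        using P polynomial_functions_compose_linear[OF \<psi>(1)]
        by (simp add: W.invariant_polynomials_iff V.invariant_polynomials_iff)
    qed
    then have "P (\<psi> (\<phi> u)) = P (\<psi> (\<phi> w))"
      using S_sep[of "\<phi> u" "\<phi> w" "\<lambda>x. P (\<psi> x)"] uw by simp
    then show ?thesis by (simp add: P_eq)
  qed
  have "f u = f w"
    if uw: "\<forall>f\<in>pullback \<phi> ` S \<union> T. f u = f w" and f: "f \<in> invariant_polynomials G sV \<rho>" for u w f
  proof -
    have uw_S: "f (\<phi> u) = f (\<phi> w)" if "f \<in> S" for f
      using bspec[OF uw, of "pullback \<phi> f"] that by (simp add: pullback_def)
    \<comment> \<open>Otherwise one function \<open>f\<close> vanishes at \<open>u\<close> and at no \<open>\<rho> a w\<close>, and the product of its translates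
      is an invariant coming from \<open>W\<close> that distinguishes \<open>u\<close> from \<open>w\<close>.\<close>
    have "\<exists>a\<in>A. \<forall>f\<in>?R. f u = f (\<rho> a w)"
    proof (rule ccontr)
      assume none: "\<not> ?thesis"
      let ?J = "{f \<in> ?R. f u = 0}"
      have R: "subalgebra_of_functions ?R" by (rule V.subalgebra_invariant_functions)
      have "\<exists>f\<in>?J. \<forall>x\<in>(\<lambda>a. \<rho> a w) ` A. f x \<noteq> 0"
      proof (rule generic_nonvanishing)
        fix x assume "x \<in> (\<lambda>a. \<rho> a w) ` A"
        then obtain f where "f \<in> ?R" "f u \<noteq> f x" using none by auto
        then show "\<exists>f\<in>?J. f x \<noteq> 0"
          using subalgebra_add[OF R _ subalgebra_const[OF R, of "- f u"], of f]
          by (intro bexI[of _ "\<lambda>v. f v + - f u"]) auto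
      qed (use \<open>finite A\<close> R subalgebra_const[OF R, of 0] in \<open>auto simp: subalgebra_of_functions_def\<close>)
      then obtain f where f: "f \<in> ?R" "f u = 0" and nz: "\<And>a. a \<in> A \<Longrightarrow> f (\<rho> a w) \<noteq> 0" by auto
      let ?H = "(\<lambda>g v. f (\<rho> g v)) ` carrier G"
      have H_A: "?H = (\<lambda>a v. f (\<rho> a v)) ` A"
      proof -
        have "\<exists>a\<in>A. (\<lambda>v. f (\<rho> g v)) = (\<lambda>v. f (\<rho> a v))" if g: "g \<in> carrier G" for g
        proof -
          obtain a where a: "a \<in> A" "restrict_to_B g = restrict_to_B a" using A(3) g by blast
          then have "f (\<rho> g v) = f (\<rho> a v)" for v
            using A(2) by (intro same_translate[OF f(1) g _ a(2)]) auto
          then show ?thesis using a(1) by (intro bexI[of _ a]) auto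
        qed
        then have "?H \<subseteq> (\<lambda>a v. f (\<rho> a v)) ` A"
          by (intro image_subsetI) (simp add: image_iff)
        moreover have "(\<lambda>a v. f (\<rho> a v)) ` A \<subseteq> ?H" using A(2) by (rule image_mono)
        ultimately show ?thesis by (rule equalityI)
      qed
      have finH: "finite ?H" unfolding H_A using A(1) by simp
      let ?P = "\<lambda>v. \<Prod>h\<in>?H. h v"
      have "?P u = ?P w"
      proof (rule descend)
        show "?P \<in> invariant_polynomials G sV \<rho>"
          using f(1) by (intro product_over_finite_translates[OF assms(1) _ finH])
            (simp add: V.invariant_functions_def)
        show "?P (v + k) = ?P v" if "k \<in> K" for k v
          using f(1) K_stable[OF _ that]
          by (intro prod.cong) (auto simp: V.action_linear V.invariant_functions_def)
      qed (rule uw_S)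
      moreover have "?P u = 0"
      proof -
        have "\<rho> \<one>\<^bsub>G\<^esub> u = u" using fun_cong[OF V.id_eq_one, of u] by simp
        then show ?thesis using f(2) one_closed
          by (intro prod_zero[OF finH]) (auto intro!: bexI[of _ "\<one>\<^bsub>G\<^esub>"])
      qed
      moreover have "?P w \<noteq> 0" using finH nz unfolding H_A by auto
      ultimately show False by simp
    qed
    then obtain a where a: "a \<in> A" "\<And>f. f \<in> ?R \<Longrightarrow> f u = f (\<rho> a w)" by blast
    have inv_sub: "invariant_polynomials G sV \<rho> \<subseteq> V.invariant_functions N {0}"
      by (auto simp: V.invariant_functions_def V.invariant_polynomials_iff N_def)
    have "\<exists>k\<in>V.span B. \<forall>f\<in>V.invariant_functions N {0}. f (\<rho> a w + k) = f u"
    proof (rule V.lift_along_pointwise_fixed_subspace[OF B(1)])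
      show "Vector_Spaces.linear sV sV \<sigma>" if "\<sigma> \<in> N" for \<sigma>
        using that V.linear_action by (auto simp: N_def)
      show "\<sigma> k = k" if "\<sigma> \<in> N" "k \<in> V.span B" for \<sigma> k
        using that B(2) by (auto simp: N_def)
      show "\<exists>f\<in>V.invariant_functions N {0}. f k \<noteq> f 0" if "k \<in> V.span B" "k \<noteq> 0" for k
        using K_sep[of k] that B(2) inv_sub by auto
      show "f u = f (\<rho> a w)" if "f \<in> V.invariant_functions N (V.span B)" for f
        using a(2) that B(2) by simp
    qed
    then obtain k where k: "k \<in> K" and agree: "\<And>f. f \<in> invariant_polynomials G sV \<rho> \<Longrightarrow> f (\<rho> a w + k) = f u"
      using B(2) inv_sub by blast
    have aG: "a \<in> carrier G" using a A(2) by blast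
    have "orbit G \<rho> (\<rho> a w + k) = orbit G \<rho> (\<rho> a w)"
    proof (rule ccontr)
      assume "orbit G \<rho> (\<rho> a w + k) \<noteq> orbit G \<rho> (\<rho> a w)"
      moreover have "\<phi> (\<rho> a w + k) = \<phi> (\<rho> a w)" using k by (simp add: \<phi>.add K_def)
      ultimately obtain h where h: "h \<in> T" "h (\<rho> a w + k) \<noteq> h (\<rho> a w)" using assms(8) by blast
      then have "h \<in> invariant_polynomials G sV \<rho>" using assms(7) by blast
      then have "h (\<rho> a w + k) = h u" "h (\<rho> a w) = h w"
        using agree aG by (auto simp: V.invariant_polynomials_iff)
      then show False using h uw by auto
    qed
    then obtain g where "g \<in> carrier G" "\<rho> g (\<rho> a w) = \<rho> a w + k" by (rule V.orbit_eqD)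
    then have "f (\<rho> a w + k) = f w" using f aG by (metis V.invariant_polynomials_iff)
    then show ?thesis using agree[OF f] by simp
  qed
  moreover have "pullback \<phi> f \<in> invariant_polynomials G sV \<rho>" if "f \<in> S" for f
  proof -
    have "f \<in> invariant_polynomials G sW \<tau>" using S that by blast
    then show ?thesis
      using polynomial_functions_compose_linear[OF assms(3)]
      by (simp add: V.invariant_polynomials_iff W.invariant_polynomials_iff pullback_def o_def equivariant)
  qed
  ultimately show ?thesis unfolding separating_set_def using assms(7) by blast
qed

end
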